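(* Let $L\in GL(\mathbb{R}^{d})$ be an invertible linear map, and let $L^{*}$ be the induced (partially defined) map $L^*\mu=(L\mu)^*$ on $\mathcal{M}^*$. Then $L^{*}$ maps ergodic fractal distributions to ergodic fractal distributions: if $P$ is an EFD, then the push-forward $L^{*}P$ is an EFD.
   Context: Fix $d\ge 1$. $\mathbb{R}^d$ carries the sup-norm; $B_r(x)$ is the closed ball, $B_r=B_r(0)$, so $B_1=[-1,1]^d$. $\mathcal{M}$ is the space of Radon measures on $\mathbb{R}^d$ with the weak topology (tested against continuous compactly supported functions). "Distribution" means a Borel probability measure on a space of measures. For $\mu\in\mathcal{M}$ with $\mu(B_1)>0$ put $\mu^*=\frac{1}{\mu(B_1)}\mu$, and $\mathcal{M}^*=\{\mu\in\mathcal{M}:\mu(B_1)=1\}$. Maps of $\mathbb{R}^d$ act on measures by push-forward. Let $T_x(y)=y-x$ and $S_t(y)=e^t y$; $T_x^*\mu=(T_x\mu)^*$, $S_t^*\mu=(S_t\mu)^*$. $S^*=(S^*_t)_{t\in\mathbb{R}}$ is an additive $\mathbb{R}$-action on $\{\mu\in\mathcal{M}^*:0\in\operatorname{supp}\mu\}$; an $S^*$-invariant distribution is understood to be concentrated on this set. For $U\subseteq\mathbb{R}^d$, $\langle\mu\rangle_U^*=\int_U\delta_{T_x^*\mu}\,d\mu(x)$. A distribution $P$ on $\mathcal{M}^*$ is quasi-Palm if for every bounded open neighborhood $U$ of $0$, $P\sim\int\langle\mu\rangle^*_U\,dP(\mu)$, where $\sim$ means having the same null sets. A fractal distribution (FD)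 is a probability distribution on $\mathcal{M}^*$ that is $S^*$-invariant and quasi-Palm; an ergodic fractal distribution (EFD) is an FD that is ergodic for $S^*$. *)

theory Defs
  imports "HOL-Probability.Probability"
begin

definition sup_ball :: "real \<Rightarrow> real^'n \<Rightarrow> (real^'n) set" where
  "sup_ball r x = {y. infnorm (y - x) \<le> r}"

abbreviation B\<^sub>1 :: "(real^'n) set" where
  "B\<^sub>1 \<equiv> sup_ball 1 0"

definition radon_measures :: "(real^'n) measure set" where
  "radon_measures = {\<mu>. sets \<mu> = sets borel
     \<and> (\<forall>K. compact K \<longrightarrow> emeasure \<mu> K < \<infinity>)
     \<and> (\<forall>A\<in>sets borel. emeasure \<mu> A = (SUP K\<in>{K. compact K \<and> K \<subseteq> A}. emeasure \<mu> K))}"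

definition test_functions :: "(real^'n \<Rightarrow> real) set" where
  "test_functions = {f. continuous_on UNIV f \<and> compact (closure {x. f x \<noteq> 0})}"

definition weak_topology :: "(real^'n) measure topology" where
  "weak_topology = topology_generated_by
     {{\<mu> \<in> radon_measures. (\<integral>x. f x \<partial>\<mu>) \<in> V} | f V. f \<in> test_functions \<and> open V}"

lemma topspace_weak_topology: "topspace weak_topology = radon_measures"
proof -
  have "(\<lambda>_. 0) \<in> test_functions"
    by (simp add: test_functions_def)
  then have "\<exists>f V. radon_measures = {\<mu> \<in> radon_measures. (\<integral>x. f x \<partial>\<mu>) \<in> V}
      \<and> f \<in> test_functions \<and> open V"
    by (intro exI[of _ "\<lambda>_. 0"] exI[of _ UNIV]) simp
  then show ?thesis
    unfolding weak_topology_def topology_generated_by_topspace by blast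
qed

definition radon_space :: "(real^'n) measure measure" where
  "radon_space = sigma radon_measures {W. openin weak_topology W}"

definition normalized :: "(real^'n) measure \<Rightarrow> (real^'n) measure" where
  "normalized \<mu> = scale_measure (1 / emeasure \<mu> B\<^sub>1) \<mu>"

definition M_star :: "(real^'n) measure set" where
  "M_star = {\<mu> \<in> radon_measures. emeasure \<mu> B\<^sub>1 = 1}"

definition M_star_space :: "(real^'n) measure measure" where
  "M_star_space = restrict_space radon_space M_star"

definition star_map :: "(real^'n \<Rightarrow> real^'n) \<Rightarrow> (real^'n) measure \<Rightarrow> (real^'n) measure" where
  "star_map f \<mu> = normalized (distr \<mu> borel f)"

text \<open>The partially defined map induced by \<open>f\<close> has domain \<open>star_dom f\<close>; outside of it the
  value of \<open>star_map f\<close> is meaningless (the scaling factor is infinite). Push-forwards are therefore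
  taken after restriction to the domain, and have total mass 1 only if the domain has full measure.\<close>

definition star_dom :: "(real^'n \<Rightarrow> real^'n) \<Rightarrow> (real^'n) measure set" where
  "star_dom f = {\<mu> \<in> M_star. emeasure (distr \<mu> borel f) B\<^sub>1 > 0}"

definition star_push ::
    "(real^'n \<Rightarrow> real^'n) \<Rightarrow> (real^'n) measure measure \<Rightarrow> (real^'n) measure measure" where
  "star_push f P = distr (restrict_space P (star_dom f)) M_star_space (star_map f)"

definition translation :: "real^'n \<Rightarrow> real^'n \<Rightarrow> real^'n" where
  "translation x y = y - x"

definition dilation :: "real \<Rightarrow> real^'n \<Rightarrow> real^'n" where
  "dilation t y = exp t *\<^sub>R y"

definition measure_supp :: "(real^'n) measure \<Rightarrow> (real^'n) set" where
  "measure_supp \<mu> = {x. \<forall>V. open V \<and> x \<in> V \<longrightarrow> emeasure \<mu> V > 0}"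

definition S_domain :: "(real^'n) measure set" where
  "S_domain = {\<mu> \<in> M_star. 0 \<in> measure_supp \<mu>}"

definition distribution_on_M_star :: "(real^'n) measure measure \<Rightarrow> bool" where
  "distribution_on_M_star P \<longleftrightarrow> prob_space P \<and> sets P = sets M_star_space"

definition S_invariant :: "(real^'n) measure measure \<Rightarrow> bool" where
  "S_invariant P \<longleftrightarrow> (AE \<mu> in P. \<mu> \<in> S_domain) \<and> (\<forall>t. star_push (dilation t) P = P)"

definition S_ergodic :: "(real^'n) measure measure \<Rightarrow> bool" where
  "S_ergodic P \<longleftrightarrow>
     (\<forall>A\<in>sets P. A \<subseteq> S_domain \<and> (\<forall>t. {\<mu> \<in> S_domain. star_map (dilation t) \<mu> \<in> A} = A)
        \<longrightarrow> measure P A = 0 \<or> measure P A = 1)"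

text \<open>The measure \<open>\<integral>\<^sub>U \<delta>(T\<^sub>x\<^sup>* \<mu>) d\<mu>(x)\<close> is the image of \<open>\<mu>\<close> restricted to \<open>U\<close>
  under \<open>x \<mapsto> T\<^sub>x\<^sup>* \<mu>\<close>. The points \<open>x\<close> at which \<open>T\<^sub>x\<^sup>* \<mu>\<close> is undefined lie
  outside the support of \<open>\<mu>\<close>, so discarding them removes only a \<open>\<mu>\<close>-null set.\<close>

definition translates :: "(real^'n) set \<Rightarrow> (real^'n) measure \<Rightarrow> (real^'n) measure measure" where
  "translates U \<mu> =
     distr (restrict_space \<mu> {x \<in> U. emeasure (distr \<mu> borel (translation x)) B\<^sub>1 > 0})
       M_star_space (\<lambda>x. star_map (translation x) \<mu>)"

text \<open>These measures need not have mass at most 1, so the Giry monad of the library does not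
  provide their average.\<close>

definition averaged_translates ::
    "(real^'n) set \<Rightarrow> (real^'n) measure measure \<Rightarrow> (real^'n) measure measure" where
  "averaged_translates U P =
     measure_of (space M_star_space) (sets M_star_space)
       (\<lambda>A. \<integral>\<^sup>+\<mu>. emeasure (translates U \<mu>) A \<partial>P)"

definition quasi_Palm :: "(real^'n) measure measure \<Rightarrow> bool" where
  "quasi_Palm P \<longleftrightarrow>
     (\<forall>U. bounded U \<and> open U \<and> 0 \<in> U \<longrightarrow> null_sets P = null_sets (averaged_translates U P))"

definition fractal_distribution :: "(real^'n) measure measure \<Rightarrow> bool" where
  "fractal_distribution P \<longleftrightarrow> distribution_on_M_star P \<and> S_invariant P \<and> quasi_Palm P"

definition ergodic_fractal_distribution :: "(real^'n) measure measure \<Rightarrow> bool" where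
  "ergodic_fractal_distribution P \<longleftrightarrow> fractal_distribution P \<and> S_ergodic P"

end

theory Submission imports Defs begin

text \<open>
  A linear bijection \<open>L\<close> commutes with every dilation \<open>S\<^sub>t\<close> and satisfies
  \<open>T\<^bsub>Ly\<^esub> \<circ> L = L \<circ> T\<^sub>y\<close>. Normalisation is a positive scalar
  factor that is absorbed by any later normalisation, so the same relations hold for the starred maps
  at every point of the support. The first relation transports invariance and ergodicity. By the second one,
  the measure that \<open>\<langle>L\<^sup>*\<mu>\<rangle>\<^sub>U\<^sup>*\<close> gives to \<open>A\<close> is a positive multiple
  of the measure that \<open>\<langle>\<mu>\<rangle>\<^sup>*\<close> over \<open>L\<^sup>-\<^sup>1U\<close> gives to the preimage of
  \<open>A\<close> under \<open>L\<^sup>*\<close>, so the two averages have corresponding null sets. What remains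
  is that all these maps are measurable for the Borel \<open>\<sigma>\<close>-algebra of the weak topology.
\<close>

section \<open>Radon measures and the weak topology\<close>

text \<open>Partiality and measurability shape the formal argument. A starred map is undefined where
  the image has no mass in \<open>B\<^sub>1\<close>, and \<open>star_push\<close> silently drops
  such measures. For homeomorphisms fixing 0 nothing is lost, since \<open>P\<close> is concentrated
  on \<open>S_domain\<close>; for a translation by x, definedness is guaranteed for x in the
  support, hence \<mu>-almost everywhere. \<open>averaged_translates\<close> is built from a set
  function, whose countable additivity is obtained from measurability of \<mu> \<mapsto>
  \<open>emeasure (translates U \<mu>) A\<close>. The set of base points measured here moves with
  \<mu>, so measurability of the mass of a fixed set does not suffice: the moving set is a section
  of a measurable subset of the product of R^d and the measures, and that subset comes from the
  joint continuity of translation in the point and the measure. Radon measures may have infinite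
  total mass, so masses are first taken inside a compact set, where complements are handled by
  subtraction.\<close>

lemma sets_radon [simp]: "\<mu> \<in> radon_measures \<Longrightarrow> sets \<mu> = sets borel"
  unfolding radon_measures_def by blast

lemma space_radon [simp]: "\<mu> \<in> radon_measures \<Longrightarrow> space \<mu> = UNIV"
  using sets_eq_imp_space_eq[OF sets_radon, of \<mu>] by simp

lemma radon_compact_finite: "\<mu> \<in> radon_measures \<Longrightarrow> compact K \<Longrightarrow> emeasure \<mu> K < \<infinity>"
  unfolding radon_measures_def by blast

lemma radon_inner_regular:
  "\<mu> \<in> radon_measures \<Longrightarrow> A \<in> sets borel \<Longrightarrow>
    emeasure \<mu> A = (SUP K\<in>{K. compact K \<and> K \<subseteq> A}. emeasure \<mu> K)"
  unfolding radon_measures_def by blast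

lemma radon_measuresI:
  assumes "sets \<mu> = sets borel" "\<And>K. compact K \<Longrightarrow> emeasure \<mu> K < \<infinity>"
    and "\<And>A. A \<in> sets borel \<Longrightarrow> emeasure \<mu> A = (SUP K\<in>{K. compact K \<and> K \<subseteq> A}. emeasure \<mu> K)"
  shows "\<mu> \<in> radon_measures"
  unfolding radon_measures_def using assms by blast

text \<open>The mass of \<open>A\<close> under the image is the \<mu>-mass of \<open>g\<close>
  A\<open>, and\<close>g\<open>maps the compact subsets of\<close>A\<open>onto the compact subsets of\<close>g
  \<open>A\<close>. A merely continuous map would not do: preimages of compact sets could have
  infinite mass.\<close>

lemma radon_distr_homeomorphism:
  fixes f g :: "real^'n \<Rightarrow> real^'n"
  assumes \<mu>: "\<mu> \<in> radon_measures" and h: "homeomorphism UNIV UNIV f g"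
  shows "distr \<mu> borel f \<in> radon_measures"
proof -
  have cf: "continuous_on UNIV f" and cg: "continuous_on UNIV g"
    and fg: "\<And>x. f (g x) = x" and gf: "\<And>x. g (f x) = x"
    using h by (auto simp: homeomorphism_def)
  have [measurable]: "f \<in> borel_measurable \<mu>"
    using borel_measurable_continuous_onI[OF cf] \<mu> by (simp cong: measurable_cong_sets)
  have vim: "f -` A = g ` A" for A
    by (auto simp: fg intro!: image_eqI[where x = "f _"] gf[symmetric])
  have em: "emeasure (distr \<mu> borel f) A = emeasure \<mu> (g ` A)" if "A \<in> sets borel" for A
    using that \<mu> by (simp add: emeasure_distr vim)
  have ck: "compact (g ` K)" "compact (f ` K)" if "compact K" for K
    using that continuous_on_subset[OF cf] continuous_on_subset[OF cg]
    by (auto intro!: compact_continuous_image)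
  have reg: "emeasure (distr \<mu> borel f) A
      = (SUP K\<in>{K. compact K \<and> K \<subseteq> A}. emeasure (distr \<mu> borel f) K)"
    if A: "A \<in> sets borel" for A
  proof -
    have gA: "g ` A \<in> sets borel"
      using measurable_sets[OF borel_measurable_continuous_onI[OF cf] A] by (simp add: vim)
    have "(\<lambda>K. g ` K) ` {K. compact K \<and> K \<subseteq> A} = {K. compact K \<and> K \<subseteq> g ` A}"
    proof (intro equalityI subsetI)
      fix K assume "K \<in> {K. compact K \<and> K \<subseteq> g ` A}"
      then have "compact (f ` K)" "f ` K \<subseteq> A" "K = g ` (f ` K)"
        using ck fg gf by (auto simp: image_image)
      then show "K \<in> (\<lambda>K. g ` K) ` {K. compact K \<and> K \<subseteq> A}" by blast
    qed (use ck in auto)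
    then have "emeasure \<mu> (g ` A) = (SUP K\<in>(\<lambda>K. g ` K) ` {K. compact K \<and> K \<subseteq> A}. emeasure \<mu> K)"
      by (simp only: radon_inner_regular[OF \<mu> gA])
    also have "\<dots> = (SUP K\<in>{K. compact K \<and> K \<subseteq> A}. emeasure (distr \<mu> borel f) K)"
      unfolding image_image by (intro SUP_cong refl) (simp add: em borel_compact)
    finally show ?thesis by (simp add: em A)
  qed
  show ?thesis
    using radon_compact_finite[OF \<mu> ck(1)]
    by (intro radon_measuresI reg) (auto simp: em borel_compact)
qed

lemma radon_scale:
  assumes \<mu>: "\<mu> \<in> radon_measures" and c: "c < \<infinity>"
  shows "scale_measure c \<mu> \<in> radon_measures"
proof -
  have "c * emeasure \<mu> A = (SUP K\<in>{K. compact K \<and> K \<subseteq> A}. c * emeasure \<mu> K)"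
    if "A \<in> sets borel" for A
    by (subst radon_inner_regular[OF \<mu> that]) (rule SUP_mult_left_ennreal)
  then show ?thesis
    using \<mu> c radon_compact_finite[OF \<mu>]
    by (intro radon_measuresI) (auto simp: ennreal_mult_less_top)
qed

section \<open>Test functions and their integrals\<close>

lemma test_function_continuous: "f \<in> test_functions \<Longrightarrow> continuous_on UNIV f"
  by (simp add: test_functions_def)

lemma test_function_measurable: "f \<in> test_functions \<Longrightarrow> f \<in> borel_measurable borel"
  by (simp add: test_functions_def borel_measurable_continuous_onI)

lemma test_functionI:
  fixes f :: "real^'n \<Rightarrow> real"
  assumes "continuous_on UNIV f" "compact K" "\<And>x. x \<notin> K \<Longrightarrow> f x = 0"
  shows "f \<in> test_functions"
proof -
  have "{x. f x \<noteq> 0} \<subseteq> K" using assms(3) by blast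
  then have "compact (closure {x. f x \<noteq> 0})"
    using assms(2) compact_closure bounded_subset compact_imp_bounded by blast
  then show ?thesis using assms(1) by (simp add: test_functions_def)
qed

lemma test_functionE:
  fixes f :: "real^'n \<Rightarrow> real"
  assumes "f \<in> test_functions"
  obtains K B where "compact K" "\<And>x. x \<notin> K \<Longrightarrow> f x = 0" "\<And>x. \<bar>f x\<bar> \<le> B"
proof -
  let ?K = "closure {x. f x \<noteq> 0}"
  have K: "compact ?K" and c: "continuous_on UNIV f" using assms by (auto simp: test_functions_def)
  have out: "f x = 0" if "x \<notin> ?K" for x using that closure_subset[of "{x. f x \<noteq> 0}"] by blast
  have "bounded (f ` ?K)"
    by (intro compact_imp_bounded compact_continuous_image[OF continuous_on_subset[OF c] K] subset_UNIV)
  then obtain B where B: "\<And>x. x \<in> ?K \<Longrightarrow> \<bar>f x\<bar> \<le> B"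
    by (auto simp: bounded_iff)
  have "\<bar>f x\<bar> \<le> max 0 B" for x
    using B[of x] out[of x] by (cases "x \<in> ?K") auto
  then show ?thesis using that K out by blast
qed

lemma test_function_integrable:
  assumes f: "f \<in> test_functions" and \<mu>: "\<mu> \<in> radon_measures"
  shows "integrable \<mu> f"
proof -
  obtain K B where K: "compact K" "\<And>x. x \<notin> K \<Longrightarrow> f x = 0" "\<And>x. \<bar>f x\<bar> \<le> B"
    using test_functionE[OF f] by blast
  show ?thesis
  proof (rule integrableI_bounded_set[of K])
    show "f \<in> borel_measurable \<mu>"
      using test_function_measurable[OF f] \<mu> by (simp cong: measurable_cong_sets)
  qed (use K \<mu> radon_compact_finite[OF \<mu> K(1)] in \<open>auto simp: borel_compact\<close>)
qed

section \<open>Continuity and Borel measurability for the weak topology\<close>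

lemma weak_open_subset: "openin weak_topology W \<Longrightarrow> W \<subseteq> radon_measures"
  by (metis openin_subset topspace_weak_topology)

lemma space_radon_space [simp]: "space radon_space = radon_measures"
  unfolding radon_space_def
  by (rule space_measure_of) (auto dest: weak_open_subset)

lemma weak_open_in_radon_space: "openin weak_topology W \<Longrightarrow> W \<in> sets radon_space"
  unfolding radon_space_def
  by (subst sets_measure_of) (auto dest: weak_open_subset)

lemma weak_open_integral:
  assumes "f \<in> test_functions" "open V"
  shows "openin weak_topology {\<mu> \<in> radon_measures. (\<integral>x. f x \<partial>\<mu>) \<in> V}"
proof -
  have "{\<mu> \<in> radon_measures. (\<integral>x. f x \<partial>\<mu>) \<in> V} \<in> 
    {{\<mu> \<in> radon_measures. (\<integral>x. f x \<partial>\<mu>) \<in> V} | f V. f \<in> test_functions \<and> open V}"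
    using assms by auto
  then show ?thesis
    unfolding weak_topology_def by (rule topology_generated_by_Basis)
qed

lemma continuous_map_weak_integral:
  "f \<in> test_functions \<Longrightarrow> continuous_map weak_topology euclideanreal (\<lambda>\<mu>. \<integral>x. f x \<partial>\<mu>)"
  by (simp add: continuous_map topspace_weak_topology weak_open_integral)

text \<open>The universal property of an initial topology. The source is an arbitrary topology so
  that products with the reals or with R^d are covered.\<close>

lemma continuous_map_into_weak:
  fixes F :: "'a \<Rightarrow> (real^'n) measure"
  assumes "\<And>x. x \<in> topspace T \<Longrightarrow> F x \<in> radon_measures"
    and "\<And>f. f \<in> test_functions \<Longrightarrow> continuous_map T euclideanreal (\<lambda>x. \<integral>y. f y \<partial>F x)"
  shows "continuous_map T weak_topology F"
  unfolding weak_topology_def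
proof (rule continuous_on_generated_topo)
  fix U :: "(real^'n) measure set"
  assume "U \<in> {{\<mu> \<in> radon_measures. (\<integral>x. f x \<partial>\<mu>) \<in> V} | f V. f \<in> test_functions \<and> open V}"
  then obtain f V where fV: "f \<in> test_functions" "open V"
    and U: "U = {\<mu> \<in> radon_measures. (\<integral>x. f x \<partial>\<mu>) \<in> V}" by blast
  have "F -` U \<inter> topspace T = {x \<in> topspace T. (\<integral>y. f y \<partial>F x) \<in> V}"
    using assms(1) by (auto simp: U)
  then show "openin T (F -` U \<inter> topspace T)"
    using assms(2)[OF fV(1)] fV(2) by (simp add: continuous_map)
next
  have "\<Union>{{\<mu> \<in> radon_measures. (\<integral>x. f x \<partial>\<mu>) \<in> V} | f V. f \<in> test_functions \<and> open V}
      = (radon_measures :: (real^'n) measure set)"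
    using topspace_weak_topology unfolding weak_topology_def topology_generated_by_topspace .
  then show "F ` topspace T \<subseteq> \<Union>{{\<mu> \<in> radon_measures. (\<integral>x. f x \<partial>\<mu>) \<in> V} | f V. f \<in> test_functions \<and> open V}"
    using assms(1) by (simp only: image_subset_iff) simp
qed

lemma weak_continuous_measurable:
  assumes "continuous_map weak_topology weak_topology F"
  shows "F \<in> measurable radon_space radon_space"
  unfolding radon_space_def[where 'n='b]
proof (rule measurable_measure_of)
  show "F \<in> space radon_space \<rightarrow> radon_measures"
    using continuous_map_funspace[OF assms] by (simp add: topspace_weak_topology)
  fix W assume "W \<in> {W. openin (weak_topology :: (real^'b) measure topology) W}"
  then have "openin weak_topology {x \<in> topspace weak_topology. F x \<in> W}"
    using assms by (simp add: continuous_map)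
  moreover have "{x \<in> topspace weak_topology. F x \<in> W} = F -` W \<inter> space radon_space"
    by (auto simp: topspace_weak_topology)
  ultimately show "F -` W \<inter> space radon_space \<in> sets radon_space"
    by (metis weak_open_in_radon_space)
qed (auto dest: weak_open_subset)

text \<open>The product of the Borel \<open>\<sigma>\<close>-algebras contains the open sets of the product as soon as one of
  the two factors is second countable; second countability of the weak topology is not needed.\<close>
lemma weak_continuous_measurable_pair:
  fixes F :: "'a::second_countable_topology \<times> (real^'n) measure \<Rightarrow> (real^'m) measure"
  assumes "continuous_map (prod_topology euclidean weak_topology) weak_topology F"
  shows "F \<in> measurable (borel \<Otimes>\<^sub>M radon_space) radon_space"
  unfolding radon_space_def[where 'n='m]
proof (rule measurable_measure_of)
  show "F \<in> space (borel \<Otimes>\<^sub>M radon_space) \<rightarrow> radon_measures"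
    using continuous_map_funspace[OF assms] by (simp add: topspace_weak_topology space_pair_measure)
  fix W assume "W \<in> {W. openin (weak_topology :: (real^'m) measure topology) W}"
  then have "openin (prod_topology euclidean weak_topology)
      {x \<in> topspace (prod_topology euclidean weak_topology). F x \<in> W}"
    using assms by (simp add: continuous_map)
  moreover have "{x \<in> topspace (prod_topology euclidean weak_topology). F x \<in> W}
      = F -` W \<inter> space (borel \<Otimes>\<^sub>M radon_space)"
    by (auto simp: topspace_weak_topology space_pair_measure)
  ultimately have op: "openin (prod_topology euclidean weak_topology)
      (F -` W \<inter> space (borel \<Otimes>\<^sub>M radon_space))" (is "openin _ ?S") by simp
  obtain B :: "'a set set" where B: "countable B" "topological_basis B"
    using ex_countable_basis by blast
  \<comment> \<open>The largest open set that fits over the basis set \<open>b\<close>. Taking all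
    such sets at once leaves one rectangle per \<open>b\<close>, so the union below is
    countable.\<close>
  define V where "V b = \<Union>{V. openin weak_topology V \<and> b \<times> V \<subseteq> ?S}" for b :: "'a set"
  have V: "openin weak_topology (V b)" for b unfolding V_def by auto
  have "?S = (\<Union>b\<in>B. b \<times> V b)"
  proof (intro equalityI subsetI)
    fix p assume p: "p \<in> ?S"
    obtain x \<mu> where xm: "p = (x, \<mu>)" by force
    with p obtain U V' where U: "open U" "x \<in> U" "openin weak_topology V'" "\<mu> \<in> V'" "U \<times> V' \<subseteq> ?S"
      using op unfolding openin_prod_topology_alt by (metis open_openin)
    obtain b where "b \<in> B" "x \<in> b" "b \<subseteq> U"
      using topological_basisE[OF B(2) U(1,2)] by metis
    then show "p \<in> (\<Union>b\<in>B. b \<times> V b)"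
      using U xm unfolding V_def by blast
  next
    fix p assume "p \<in> (\<Union>b\<in>B. b \<times> V b)"
    then show "p \<in> ?S" unfolding V_def by blast
  qed
  moreover have "(\<Union>b\<in>B. b \<times> V b) \<in> sets (borel \<Otimes>\<^sub>M radon_space)"
    using B V by (intro sets.countable_UN'' pair_measureI)
      (auto intro: weak_open_in_radon_space dest: topological_basis_open)
  ultimately show "?S \<in> sets (borel \<Otimes>\<^sub>M radon_space)" by simp
qed (auto dest: weak_open_subset)

section \<open>Continuity of scaling and push-forward\<close>

lemma borel_measurable_radon: "\<mu> \<in> radon_measures \<Longrightarrow> f \<in> borel_measurable borel \<Longrightarrow> f \<in> borel_measurable \<mu>"
  by (simp cong: measurable_cong_sets)

text \<open>Continuity is joint because the normalising factor itself depends on the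
  measure.\<close>

lemma continuous_scale:
  "continuous_map (prod_topology euclideanreal weak_topology) weak_topology
     (\<lambda>(c, \<mu>). scale_measure (ennreal c) \<mu>)"
proof (rule continuous_map_into_weak)
  show "(case p of (c, \<mu>) \<Rightarrow> scale_measure (ennreal c) \<mu>) \<in> radon_measures"
    if "p \<in> topspace (prod_topology euclideanreal weak_topology)" for p
    using that by (auto simp: topspace_weak_topology radon_scale)
next
  fix f :: "real^'n \<Rightarrow> real" assume f: "f \<in> test_functions"
  \<comment> \<open>\<open>ennreal\<close> sends negative reals to 0; the factor is therefore
    \<open>max 0 c\<close>, which is continuous on the whole line.\<close>
  have int: "(\<integral>y. f y \<partial>scale_measure (ennreal c) \<mu>) = max 0 c * (\<integral>y. f y \<partial>\<mu>)"
    if \<mu>: "\<mu> \<in> radon_measures" for c \<mu>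
  proof -
    have eq: "scale_measure (ennreal c) \<mu> = density \<mu> (\<lambda>_. ennreal (max 0 c))"
      by (rule measure_eqI) (auto simp: emeasure_density_const max_def ennreal_neg)
    show ?thesis
      unfolding eq using borel_measurable_radon[OF \<mu> test_function_measurable[OF f]]
      by (subst integral_density) auto
  qed
  have "continuous_map (prod_topology euclideanreal weak_topology) euclideanreal
      (\<lambda>p. max 0 (fst p) * (\<integral>y. f y \<partial>snd p))"
    using continuous_map_compose[OF continuous_map_snd continuous_map_weak_integral[OF f], of euclideanreal]
    by (intro continuous_intros) (auto simp: o_def)
  then show "continuous_map (prod_topology euclideanreal weak_topology) euclideanreal
      (\<lambda>p. \<integral>y. f y \<partial>(case p of (c, \<mu>) \<Rightarrow> scale_measure (ennreal c) \<mu>))"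
    by (rule continuous_map_eq) (auto simp: topspace_weak_topology int)
qed

text \<open>By change of variables it suffices that composing a test function with \<open>f\<close>
  gives a test function; its support stays compact because it lies in the image of a compact set
  under \<open>g\<close>.\<close>

lemma continuous_distr_homeomorphism:
  fixes f g :: "real^'n \<Rightarrow> real^'n"
  assumes h: "homeomorphism UNIV UNIV f g"
  shows "continuous_map weak_topology weak_topology (\<lambda>\<mu>. distr \<mu> borel f)"
proof (rule continuous_map_into_weak)
  show "distr \<mu> borel f \<in> radon_measures" if "\<mu> \<in> topspace weak_topology" for \<mu>
    using that by (simp add: topspace_weak_topology radon_distr_homeomorphism[OF _ h])
next
  fix \<phi> :: "real^'n \<Rightarrow> real" assume \<phi>: "\<phi> \<in> test_functions"
  obtain K where K: "compact K" "\<And>x. x \<notin> K \<Longrightarrow> \<phi> x = 0"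
    using test_functionE[OF \<phi>] by metis
  have c: "continuous_on UNIV f" "continuous_on UNIV g" and gf: "g (f x) = x" for x
    using h by (auto simp: homeomorphism_def)
  have "(\<lambda>x. \<phi> (f x)) \<in> test_functions"
  proof (rule test_functionI)
    show "continuous_on UNIV (\<lambda>x. \<phi> (f x))"
      by (rule continuous_on_compose2[OF test_function_continuous[OF \<phi>] c(1)]) simp
    show "compact (g ` K)"
      by (intro compact_continuous_image continuous_on_subset[OF c(2)] K) simp
    show "\<phi> (f x) = 0" if "x \<notin> g ` K" for x
      using that gf[of x] by (intro K(2)) (metis image_eqI)
  qed
  from continuous_map_weak_integral[OF this]
  show "continuous_map weak_topology euclideanreal (\<lambda>\<mu>. \<integral>x. \<phi> x \<partial>distr \<mu> borel f)"
    by (rule continuous_map_eq)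
      (simp add: integral_distr topspace_weak_topology test_function_measurable[OF \<phi>]
        borel_measurable_radon borel_measurable_continuous_onI[OF c(1)])
qed

lemma homeomorphism_translation: "homeomorphism UNIV UNIV (translation x) (translation (- x))"
  by (rule homeomorphismI) (auto simp: translation_def intro!: continuous_intros)

lemma translation_measurable: "translation x \<in> borel_measurable borel"
  unfolding translation_def by simp

text \<open>The integrand moves together with the measure. The error splits in two: replacing the
  translate by x with the one by \<open>x0\<close> costs little by uniform continuity, provided the
  masses of nearby measures on a fixed ball stay bounded, and for the fixed translate the weak
  topology suffices. A bump function supplies the mass bound.\<close>

lemma continuous_translation:
  "continuous_map (prod_topology euclidean weak_topology) weak_topology
     (\<lambda>(x :: real^'n, \<mu>). distr \<mu> borel (translation x))"
proof (rule continuous_map_into_weak)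
  show "(case p of (x, \<mu>) \<Rightarrow> distr \<mu> borel (translation x)) \<in> radon_measures"
    if "p \<in> topspace (prod_topology euclidean weak_topology)" for p :: "(real^'n) \<times> (real^'n) measure"
    using that radon_distr_homeomorphism[OF _ homeomorphism_translation]
    by (auto simp: topspace_weak_topology)
next
  fix f :: "real^'n \<Rightarrow> real" assume f: "f \<in> test_functions"
  define G where "G = (\<lambda>p :: (real^'n) \<times> (real^'n) measure. \<integral>y. f (y - fst p) \<partial>snd p)"
  obtain K where K: "compact K" "\<And>x. x \<notin> K \<Longrightarrow> f x = 0"
    using test_functionE[OF f] by metis
  obtain R0 where R0: "\<And>x. x \<in> K \<Longrightarrow> norm x \<le> R0"
    using compact_imp_bounded[OF K(1)] by (auto simp: bounded_iff)
  have cf: "continuous_on UNIV f" by (rule test_function_continuous[OF f])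
  have ft: "(\<lambda>y. f (y - x)) \<in> test_functions" for x
  proof (rule test_functionI)
    show "continuous_on UNIV (\<lambda>y. f (y - x))"
      by (rule continuous_on_compose2[OF cf]) (auto intro!: continuous_intros)
    show "compact ((+) x ` K)" by (intro compact_translation K)
    show "f (y - x) = 0" if "y \<notin> (+) x ` K" for y
      using that by (intro K(2)) (metis add_diff_cancel_left' diff_add_cancel image_eqI add.commute)
  qed
  have "continuous_map (prod_topology euclidean weak_topology) Met_TC.mtopology G"
    unfolding Met_TC.continuous_map_to_metric
  proof (intro ballI allI impI)
    fix p :: "(real^'n) \<times> (real^'n) measure" and e :: real
    assume p: "p \<in> topspace (prod_topology euclidean weak_topology)" and e: "0 < e"
    obtain x0 \<mu>0 where p_eq: "p = (x0, \<mu>0)" by force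
    with p have \<mu>0: "\<mu>0 \<in> radon_measures" by (simp add: topspace_weak_topology)
    \<comment> \<open>The ball of radius \<open>R\<close> contains the supports of all translates of
      \<open>f\<close> by points at distance less than 1 from \<open>x0\<close>.\<close>
    define R where "R = R0 + norm x0 + 1"
    \<comment> \<open>A test function that is at least 1 on that ball, so its integral bounds the
      mass there.\<close>
    define h where "h = (\<lambda>y :: real^'n. max 0 (R + 1 - norm y))"
    have h: "h \<in> test_functions"
      unfolding h_def by (rule test_functionI[of _ "cball 0 (R + 1)"]) (auto intro!: continuous_intros)
    have h0: "0 \<le> h y" and h1: "norm y \<le> R \<Longrightarrow> 1 \<le> h y" for y by (auto simp: h_def)
    \<comment> \<open>The added 1 makes \<open>M\<close> positive and makes an integral of
      \<open>h\<close> below \<open>M\<close> an open condition satisfied by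
      \<open>\<mu>0\<close>.\<close>
    define M where "M = (\<integral>y. h y \<partial>\<mu>0) + 1"
    have M: "0 < M" unfolding M_def by (intro add_nonneg_pos integral_nonneg_AE) (auto simp: h0)
    \<comment> \<open>This radius bounds y - x for y of norm at most \<open>R\<close> and x within 1
      of \<open>x0\<close>. The tolerance e / (2 * M), integrated against \<open>h\<close>, uses up
      at most half of \<open>e\<close>.\<close>
    have "uniformly_continuous_on (cball 0 (R + norm x0 + 1)) f"
      by (intro compact_uniformly_continuous continuous_on_subset[OF cf]) auto
    then obtain d where d: "0 < d" and
      d_uc: "\<And>a b. norm a \<le> R + norm x0 + 1 \<Longrightarrow> norm b \<le> R + norm x0 + 1 \<Longrightarrow> dist b a < d
        \<Longrightarrow> dist (f b) (f a) < e / (2 * M)"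
      unfolding uniformly_continuous_on_def using e M
      by (metis divide_pos_pos mult_pos_pos zero_less_numeral mem_cball_0)
    have est: "\<bar>f (y - x) - f (y - x0)\<bar> \<le> e / (2 * M) * h y" if x: "dist x x0 < min d 1" for x y
    proof (cases "norm y \<le> R")
      case True
      have n: "norm (y - x) \<le> norm y + norm x" "norm (y - x0) \<le> norm y + norm x0"
        "norm x \<le> norm x0 + 1"
        using x norm_triangle_ineq4[of y] norm_triangle_sub[of x x0] by (auto simp: dist_norm)
      have "dist (y - x) (y - x0) < d" using x by (simp add: dist_norm norm_minus_commute)
      then have "dist (f (y - x)) (f (y - x0)) < e / (2 * M)"
        using n True by (intro d_uc) auto
      also have "\<dots> \<le> e / (2 * M) * h y"
        using h1[OF True] e M by (simp add: field_simps)
      finally show ?thesis by (simp add: dist_real_def)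
    next
      case False
      have "norm y \<le> norm (y - z) + norm z" for z using norm_triangle_ineq[of "y - z" z] by simp
      from this[of x] this[of x0] have "R0 < norm (y - x)" "R0 < norm (y - x0)"
        using False x norm_triangle_sub[of x x0] by (auto simp: dist_norm R_def)
      then have "f (y - x) = 0" "f (y - x0) = 0"
        using R0 K(2) by fastforce+
      then show ?thesis using h0[of y] e M by simp
    qed
    define V where "V = {\<mu> \<in> radon_measures. (\<integral>y. h y \<partial>\<mu>) \<in> {..<M}} \<inter>
      {\<mu> \<in> radon_measures. (\<integral>y. f (y - x0) \<partial>\<mu>) \<in> ball (\<integral>y. f (y - x0) \<partial>\<mu>0) (e / 2)}"
    have V: "openin weak_topology V"
      unfolding V_def by (intro openin_Int weak_open_integral h ft) auto
    have "G q \<in> ball (G p) e" if q: "q \<in> ball x0 (min d 1) \<times> V" for q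
    proof -
      obtain x \<mu> where q_eq: "q = (x, \<mu>)" "dist x x0 < min d 1" "\<mu> \<in> V"
        using q by (auto simp: dist_commute)
      then have \<mu>: "\<mu> \<in> radon_measures" and hM: "(\<integral>y. h y \<partial>\<mu>) < M"
        and cl: "\<bar>(\<integral>y. f (y - x0) \<partial>\<mu>) - (\<integral>y. f (y - x0) \<partial>\<mu>0)\<bar> < e / 2"
        by (auto simp: V_def dist_real_def abs_minus_commute)
      note int = test_function_integrable[OF ft \<mu>] test_function_integrable[OF h \<mu>]
      have "\<bar>(\<integral>y. f (y - x) \<partial>\<mu>) - (\<integral>y. f (y - x0) \<partial>\<mu>)\<bar>
          = \<bar>\<integral>y. f (y - x) - f (y - x0) \<partial>\<mu>\<bar>" using int by simp
      also have "\<dots> \<le> (\<integral>y. \<bar>f (y - x) - f (y - x0)\<bar> \<partial>\<mu>)" by (rule integral_abs_bound)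
      also have "\<dots> \<le> (\<integral>y. e / (2 * M) * h y \<partial>\<mu>)"
        using int est q_eq(2) by (intro integral_mono) auto
      also have "\<dots> = e / (2 * M) * (\<integral>y. h y \<partial>\<mu>)" by simp
      also have "\<dots> \<le> e / (2 * M) * M" using hM e M by (intro mult_left_mono) auto
      also have "\<dots> = e / 2" using M by simp
      finally have "\<bar>(\<integral>y. f (y - x) \<partial>\<mu>) - (\<integral>y. f (y - x0) \<partial>\<mu>0)\<bar> < e / 2 + e / 2"
        using cl abs_triangle_ineq[of "(\<integral>y. f (y - x) \<partial>\<mu>) - (\<integral>y. f (y - x0) \<partial>\<mu>)"
            "(\<integral>y. f (y - x0) \<partial>\<mu>) - (\<integral>y. f (y - x0) \<partial>\<mu>0)"] by simp
      then show ?thesis by (simp add: G_def q_eq p_eq dist_real_def abs_minus_commute)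
    qed
    moreover have "openin (prod_topology euclidean weak_topology) (ball x0 (min d 1) \<times> V)"
      using V by (simp add: openin_prod_Times_iff)
    moreover have "p \<in> ball x0 (min d 1) \<times> V"
      using d e \<mu>0 by (simp add: p_eq V_def M_def)
    ultimately show "\<exists>U. openin (prod_topology euclidean weak_topology) U \<and> p \<in> U \<and> (\<forall>q\<in>U. G q \<in> Met_TC.mball (G p) e)"
      by auto
  qed
  then have "continuous_map (prod_topology euclidean weak_topology) euclideanreal G" by simp
  then show "continuous_map (prod_topology euclidean weak_topology) euclideanreal
      (\<lambda>p. \<integral>y. f y \<partial>(case p of (x, \<mu>) \<Rightarrow> distr \<mu> borel (translation x)))"
  proof (rule continuous_map_eq)
    fix p :: "(real^'n) \<times> (real^'n) measure" assume "p \<in> topspace (prod_topology euclidean weak_topology)"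
    then show "G p = (\<integral>y. f y \<partial>(case p of (x, \<mu>) \<Rightarrow> distr \<mu> borel (translation x)))"
      by (auto simp: G_def topspace_weak_topology integral_distr borel_measurable_radon
          translation_measurable test_function_measurable[OF f])
        (simp add: translation_def)
  qed
qed

section \<open>Measurability of masses\<close>

lemma compact_sup_ball: "compact (sup_ball r (x :: real^'n))"
proof -
  have "closed {y :: real^'n. infnorm (y - x) \<le> r}"
    by (intro closed_Collect_le continuous_intros)
  moreover have "bounded {y :: real^'n. infnorm (y - x) \<le> r}"
    unfolding bounded_def dist_norm
  proof (intro exI ballI)
    fix y :: "real^'n" assume "y \<in> {y. infnorm (y - x) \<le> r}"
    then show "norm (x - y) \<le> sqrt DIM(real^'n) * r"
      using norm_le_infnorm[of "y - x"] order_trans mult_left_mono[of "infnorm (y - x)" r "sqrt DIM(real^'n)"]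
      by (fastforce simp: norm_minus_commute)
  qed
  ultimately show ?thesis
    by (simp add: sup_ball_def compact_eq_bounded_closed)
qed

lemma B1_borel [measurable]: "B\<^sub>1 \<in> sets borel"
  by (rule borel_compact[OF compact_sup_ball])

lemma ball_subset_B1: "ball 0 1 \<subseteq> (B\<^sub>1 :: (real^'n) set)"
  by (auto simp: sup_ball_def intro: order_trans[OF infnorm_le_norm less_imp_le])

lemma radon_B1_finite: "\<mu> \<in> radon_measures \<Longrightarrow> emeasure \<mu> B\<^sub>1 < \<infinity>"
  by (rule radon_compact_finite[OF _ compact_sup_ball])

text \<open>The mass is a limit of weakly continuous functionals: integrals of tent functions around
  \<open>K\<close> that decrease to its indicator. The first tent has compact support and dominates
  all the others.\<close>

lemma measurable_emeasure_compact:
  fixes K :: "(real^'n) set"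
  assumes K: "compact K"
  shows "(\<lambda>\<mu>. emeasure \<mu> K) \<in> borel_measurable radon_space"
\<comment> \<open>By convention \<open>infdist\<close> to the empty set is 0, so the tents would be
  constantly 1 there.\<close>
proof (cases "K = {}")
  case False
  define f where "f n y = max 0 (1 - real (Suc n) * infdist y K)" for n and y :: "real^'n"
  have ft: "f n \<in> test_functions" for n
  proof (rule test_functionI)
    show "continuous_on UNIV (f n)" unfolding f_def by (intro continuous_intros)
    show "compact {y. infdist y K \<le> 1}" by (rule compact_infdist_le[OF False K]) simp
    show "f n y = 0" if "y \<notin> {y. infdist y K \<le> 1}" for y
    proof -
      have "1 * 1 \<le> real (Suc n) * infdist y K" using that by (intro mult_mono) auto
      then show ?thesis by (simp add: f_def)
    qed
  qed
  have lim: "(\<lambda>n. \<integral>y. f n y \<partial>\<mu>) \<longlonglongrightarrow> measure \<mu> K" if \<mu>: "\<mu> \<in> radon_measures" for \<mu>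
  proof -
    have "(\<lambda>n. \<integral>y. f n y \<partial>\<mu>) \<longlonglongrightarrow> (\<integral>y. indicator K y \<partial>\<mu>)"
    proof (rule integral_dominated_convergence[where w = "f 0"])
      show "AE y in \<mu>. (\<lambda>n. f n y) \<longlonglongrightarrow> indicator K y"
      proof (rule AE_I2)
        fix y
        show "(\<lambda>n. f n y) \<longlonglongrightarrow> indicator K y"
        proof (cases "y \<in> K")
          case True
          then show ?thesis by (simp add: f_def)
        next
          case F: False
          then have pos: "0 < infdist y K"
            using in_closed_iff_infdist_zero[OF compact_imp_closed[OF K] False, of y] infdist_nonneg[of y K]
            by linarith
          obtain N where N: "1 / infdist y K < real N" using reals_Archimedean2 by blast
          have "f n y = 0" if "N \<le> n" for n
          proof -
            have "1 / infdist y K < real (Suc n)" using N that by linarith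
            then show ?thesis using pos by (simp add: f_def divide_less_eq)
          qed
          then have "eventually (\<lambda>n. f n y = indicator K y) sequentially"
            using F by (auto simp: eventually_sequentially)
          then show ?thesis by (rule tendsto_eventually)
        qed
      qed
      show "AE y in \<mu>. norm (f n y) \<le> f 0 y" for n
      proof (rule AE_I2)
        fix y
        have "1 * infdist y K \<le> real (Suc n) * infdist y K" by (intro mult_right_mono) (auto simp: infdist_nonneg)
        then show "norm (f n y) \<le> f 0 y" by (simp add: f_def max_def del: of_nat_Suc)
      qed
    qed (use \<mu> test_function_integrable[OF ft \<mu>] borel_compact[OF K] in
        \<open>auto intro!: borel_measurable_indicator\<close>)
    then show ?thesis using \<mu> borel_compact[OF K] by simp
  qed
  have "(\<lambda>\<mu>. measure \<mu> K) \<in> borel_measurable radon_space"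
  proof (rule borel_measurable_LIMSEQ_real[OF lim])
    show "(\<lambda>\<mu>. \<integral>y. f n y \<partial>\<mu>) \<in> borel_measurable radon_space" for n
    proof (rule borel_measurableI)
      fix S :: "real set" assume "open S"
      from weak_open_in_radon_space[OF weak_open_integral[OF ft this]]
      show "(\<lambda>\<mu>. \<integral>y. f n y \<partial>\<mu>) -` S \<inter> space radon_space \<in> sets radon_space"
        by (simp add: vimage_def Int_def conj_commute)
    qed
  qed simp
  then have "(\<lambda>\<mu>. ennreal (measure \<mu> K)) \<in> borel_measurable radon_space" by simp
  then show ?thesis
    using radon_compact_finite[OF _ K]
    by (subst measurable_cong[where g = "\<lambda>\<mu>. ennreal (measure \<mu> K)"])
      (auto simp: emeasure_eq_ennreal_measure less_top)
qed simp

text \<open>Dynkin's argument, starting from the closed sets. The compact \<open>C\<close> keeps all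
  masses finite, so the complement step is a genuine subtraction.\<close>

lemma measurable_emeasure_bounded:
  fixes C :: "(real^'n) set"
  assumes C: "compact C" and A: "A \<in> sets borel"
  shows "(\<lambda>\<mu>. emeasure \<mu> (A \<inter> C)) \<in> borel_measurable radon_space"
proof -
  have "Int_stable (Collect closed :: (real^'n) set set)" "Collect closed \<subseteq> Pow (UNIV :: (real^'n) set)"
    by (auto simp: Int_stable_def)
  moreover have "A \<in> sigma_sets UNIV (Collect closed)"
    using A unfolding borel_eq_closed by simp
  ultimately show ?thesis
  proof (induction rule: sigma_sets_induct_disjoint)
    case (basic A)
    then show ?case using C by (intro measurable_emeasure_compact) (simp add: closed_Int_compact)
  next
    case empty then show ?case by simp
  next
    case (compl A)
    then have A: "A \<in> sets borel" by (simp add: borel_eq_closed)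
    have "emeasure \<mu> ((UNIV - A) \<inter> C) = emeasure \<mu> C - emeasure \<mu> (A \<inter> C)" if "\<mu> \<in> radon_measures" for \<mu>
    proof -
      have "emeasure \<mu> (A \<inter> C) \<noteq> \<infinity>"
        using radon_compact_finite[OF that C] emeasure_mono[of "A \<inter> C" C \<mu>] that borel_compact[OF C]
        by (auto simp: top_unique)
      then have "emeasure \<mu> (C - (A \<inter> C)) = emeasure \<mu> C - emeasure \<mu> (A \<inter> C)"
        using A that borel_compact[OF C] by (intro emeasure_Diff) auto
      moreover have "(UNIV - A) \<inter> C = C - (A \<inter> C)" by auto
      ultimately show ?thesis by simp
    qed
    then show ?case
      using compl.IH measurable_emeasure_compact[OF C]
      by (subst measurable_cong[where g = "\<lambda>\<mu>. emeasure \<mu> C - emeasure \<mu> (A \<inter> C)"]) auto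
  next
    case (union A)
    then have A: "A i \<in> sets borel" for i by (auto simp: borel_eq_closed)
    have "emeasure \<mu> ((\<Union>i. A i) \<inter> C) = (\<Sum>i. emeasure \<mu> (A i \<inter> C))" if "\<mu> \<in> radon_measures" for \<mu>
      using A that union(1) borel_compact[OF C]
      by (subst suminf_emeasure) (auto simp: disjoint_family_on_def)
    then show ?case
      using union.IH
      by (subst measurable_cong[where g = "\<lambda>\<mu>. \<Sum>i. emeasure \<mu> (A i \<inter> C)"]) auto
  qed
qed

text \<open>Here the measured set depends on the parameter as well as the measure does. For a
  rectangle the mass is an indicator times the mass of a fixed set; the rest is Dynkin's argument,
  again with \<open>C\<close> providing finiteness.\<close>

lemma measurable_emeasure_section:
  fixes C :: "(real^'n) set"
  assumes F: "F \<in> measurable N radon_space" and C: "compact C"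
    and E: "E \<in> sets (borel \<Otimes>\<^sub>M N)"
  shows "(\<lambda>z. emeasure (F z) {x \<in> C. (x, z) \<in> E}) \<in> borel_measurable N"
proof -
  have Fz: "F z \<in> radon_measures" if "z \<in> space N" for z
    using measurable_space[OF F that] by simp
  have sec: "{x. (x, z) \<in> E} \<in> sets borel" if "E \<in> sets (borel \<Otimes>\<^sub>M N)" for E z
    using sets_Pair2[OF that, of z] by (simp add: vimage_def)
  have "E \<in> sigma_sets (space borel \<times> space N) {a \<times> b | a b. a \<in> sets borel \<and> b \<in> sets N}"
    using E by (simp add: sets_pair_measure)
  with Int_stable_pair_measure_generator pair_measure_closed show ?thesis
  proof (induction rule: sigma_sets_induct_disjoint)
    case (basic E)
    then obtain a b where ab: "E = a \<times> b" "a \<in> sets borel" "b \<in> sets N" by blast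
    have "emeasure (F z) {x \<in> C. (x, z) \<in> E} = indicator b z * emeasure (F z) (a \<inter> C)" for z
      by (auto simp: ab indicator_def Int_def conj_commute)
    then show ?case
      using measurable_compose[OF F measurable_emeasure_bounded[OF C ab(2)]] ab(3) by simp
  next
    case empty then show ?case by simp
  next
    case (compl E)
    then have E: "E \<in> sets (borel \<Otimes>\<^sub>M N)" by (simp add: sets_pair_measure)
    have "emeasure (F z) {x \<in> C. (x, z) \<in> space borel \<times> space N - E}
        = emeasure (F z) C - emeasure (F z) {x \<in> C. (x, z) \<in> E}" if z: "z \<in> space N" for z
    proof -
      have m: "{x \<in> C. (x, z) \<in> E} \<in> sets (F z)"
        using sec[OF E, of z] borel_compact[OF C] Fz[OF z] by (simp add: Collect_conj_eq)
      have "emeasure (F z) {x \<in> C. (x, z) \<in> E} \<noteq> \<infinity>"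
        using radon_compact_finite[OF Fz[OF z] C] emeasure_mono[of "{x \<in> C. (x, z) \<in> E}" C "F z"]
          Fz[OF z] borel_compact[OF C] by (auto simp: top_unique)
      then have "emeasure (F z) (C - {x \<in> C. (x, z) \<in> E}) = emeasure (F z) C - emeasure (F z) {x \<in> C. (x, z) \<in> E}"
        using m Fz[OF z] borel_compact[OF C] by (intro emeasure_Diff) auto
      moreover have "{x \<in> C. (x, z) \<in> space borel \<times> space N - E} = C - {x \<in> C. (x, z) \<in> E}" using z by auto
      ultimately show ?thesis by simp
    qed
    then show ?case
      using compl.IH measurable_compose[OF F measurable_emeasure_compact[OF C]]
      by (subst measurable_cong[where g = "\<lambda>z. emeasure (F z) C - emeasure (F z) {x \<in> C. (x, z) \<in> E}"]) auto
  next
    case (union E)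
    then have E: "E i \<in> sets (borel \<Otimes>\<^sub>M N)" for i by (auto simp: sets_pair_measure)
    have "emeasure (F z) {x \<in> C. (x, z) \<in> (\<Union>i. E i)} = (\<Sum>i. emeasure (F z) {x \<in> C. (x, z) \<in> E i})"
      if z: "z \<in> space N" for z
    proof -
      have m: "{x \<in> C. (x, z) \<in> E i} \<in> sets (F z)" for i
        using sec[OF E, of z] borel_compact[OF C] Fz[OF z] by (simp add: Collect_conj_eq)
      have "{x \<in> C. (x, z) \<in> (\<Union>i. E i)} = (\<Union>i. {x \<in> C. (x, z) \<in> E i})" by auto
      moreover have "disjoint_family (\<lambda>i. {x \<in> C. (x, z) \<in> E i})"
        using union(1) unfolding disjoint_family_on_def by blast
      ultimately show ?thesis using m by (subst suminf_emeasure) auto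
    qed
    then show ?case
      using union.IH
      by (subst measurable_cong[where g = "\<lambda>z. \<Sum>i. emeasure (F z) {x \<in> C. (x, z) \<in> E i}"]) auto
  qed
qed

section \<open>Normalised push-forwards\<close>

lemma M_star_radon: "\<mu> \<in> M_star \<Longrightarrow> \<mu> \<in> radon_measures"
  by (simp add: M_star_def)

lemma space_M_star_space [simp]: "space M_star_space = M_star"
  by (auto simp: M_star_space_def space_restrict_space M_star_def)

lemma M_star_to_radon: "(\<lambda>\<mu>. \<mu>) \<in> measurable M_star_space radon_space"
  unfolding M_star_space_def by (rule measurable_restrict_space1) simp

lemma distr_scale_measure:
  assumes "f \<in> measurable \<mu> N"
  shows "distr (scale_measure c \<mu>) N f = scale_measure c (distr \<mu> N f)"
proof (rule measure_eqI)
  have "f \<in> measurable (scale_measure c \<mu>) N"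
    using assms by (simp add: measurable_def space_scale_measure)
  then show "emeasure (distr (scale_measure c \<mu>) N f) A = emeasure (scale_measure c (distr \<mu> N f)) A"
    if "A \<in> sets (distr (scale_measure c \<mu>) N f)" for A
    using that assms by (simp add: emeasure_distr space_scale_measure)
qed simp

lemma normalized_scale_measure:
  assumes c: "0 < c" "c < \<infinity>" and \<mu>: "0 < emeasure \<mu> B\<^sub>1" "emeasure \<mu> B\<^sub>1 < \<infinity>"
  shows "normalized (scale_measure c \<mu>) = normalized \<mu>"
proof -
  obtain c' m where cm: "c = ennreal c'" "0 < c'" "emeasure \<mu> B\<^sub>1 = ennreal m" "0 < m"
    using c \<mu> by (cases c; cases "emeasure \<mu> B\<^sub>1") (auto simp: ennreal_less_zero_iff)
  have "1 / (c * emeasure \<mu> B\<^sub>1) * c = 1 / emeasure \<mu> B\<^sub>1"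
    using cm by (simp add: ennreal_mult[symmetric] divide_ennreal ennreal_1[symmetric] del: ennreal_1)
  then show ?thesis by (simp add: normalized_def)
qed

text \<open>Expresses the factor by a real number, since joint continuity of scaling is available
  for real parameters.\<close>

lemma normalized_factor:
  assumes "0 < emeasure \<mu> B\<^sub>1" "emeasure \<mu> B\<^sub>1 < \<infinity>"
  shows "1 / emeasure \<mu> B\<^sub>1 = ennreal (1 / measure \<mu> B\<^sub>1)"
    and "0 < 1 / emeasure \<mu> B\<^sub>1" and "1 / emeasure \<mu> B\<^sub>1 < \<infinity>"
proof -
  obtain m where m: "emeasure \<mu> B\<^sub>1 = ennreal m" "0 < m"
    using assms by (cases "emeasure \<mu> B\<^sub>1") auto
  then have "measure \<mu> B\<^sub>1 = m" by (simp add: measure_def)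
  then show eq: "1 / emeasure \<mu> B\<^sub>1 = ennreal (1 / measure \<mu> B\<^sub>1)"
    using m by (simp add: divide_ennreal ennreal_1[symmetric] del: ennreal_1)
  show "0 < 1 / emeasure \<mu> B\<^sub>1" "1 / emeasure \<mu> B\<^sub>1 < \<infinity>"
    using m \<open>measure \<mu> B\<^sub>1 = m\<close> unfolding eq by auto
qed

lemma normalized_in_M_star:
  assumes "\<mu> \<in> radon_measures" "0 < emeasure \<mu> B\<^sub>1"
  shows "normalized \<mu> \<in> M_star"
proof -
  note fin = radon_B1_finite[OF assms(1)]
  obtain m where m: "emeasure \<mu> B\<^sub>1 = ennreal m" "0 < m"
    using assms(2) fin by (cases "emeasure \<mu> B\<^sub>1") auto
  then have "1 / emeasure \<mu> B\<^sub>1 * emeasure \<mu> B\<^sub>1 = 1"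
    by (simp add: divide_ennreal ennreal_mult[symmetric] ennreal_1[symmetric] del: ennreal_1)
  then show ?thesis
    using radon_scale[OF assms(1) normalized_factor(3)[OF assms(2) fin]]
    by (simp add: M_star_def normalized_def)
qed

text \<open>Where the mass of \<open>B\<^sub>1\<close> vanishes, the factor is infinite and the
  normalised measure need not be Radon. A total measurable substitute is used instead, and the bad
  points are removed afterwards.\<close>

lemma normalized_set_measurable:
  assumes D: "D \<in> measurable N radon_space" and A: "A \<in> sets M_star_space"
  shows "{z \<in> space N. 0 < emeasure (D z) B\<^sub>1 \<and> normalized (D z) \<in> A} \<in> sets N"
proof -
  \<comment> \<open>Real division gives 1 / 0 = 0, so at the bad points this is the zero measure,
    which is Radon.\<close>
  define D' where "D' z = scale_measure (ennreal (1 / measure (D z) B\<^sub>1)) (D z)" for z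
  have em: "(\<lambda>z. emeasure (D z) B\<^sub>1) \<in> borel_measurable N"
    by (rule measurable_compose[OF D measurable_emeasure_compact[OF compact_sup_ball]])
  then have "(\<lambda>z. (1 / measure (D z) B\<^sub>1, D z)) \<in> measurable N (borel \<Otimes>\<^sub>M radon_space)"
    using D unfolding measure_def by measurable
  from measurable_compose[OF this weak_continuous_measurable_pair[OF continuous_scale]]
  have D': "D' \<in> measurable N radon_space" by (simp add: D'_def[abs_def])
  have em': "(\<lambda>z. emeasure (D' z) B\<^sub>1) \<in> borel_measurable N"
    by (rule measurable_compose[OF D' measurable_emeasure_compact[OF compact_sup_ball]])
  obtain A' where A': "A' \<in> sets radon_space" "A = M_star \<inter> A'"
    using A by (auto simp: M_star_space_def sets_restrict_space)
  have "normalized (D z) = D' z" "normalized (D z) \<in> M_star"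
    if "z \<in> space N" "0 < emeasure (D z) B\<^sub>1" for z
  proof -
    have rad: "D z \<in> radon_measures" using measurable_space[OF D that(1)] by simp
    show "normalized (D z) = D' z"
      unfolding normalized_def D'_def normalized_factor(1)[OF that(2) radon_B1_finite[OF rad]] ..
    show "normalized (D z) \<in> M_star" by (rule normalized_in_M_star[OF rad that(2)])
  qed
  then have "{z \<in> space N. 0 < emeasure (D z) B\<^sub>1 \<and> normalized (D z) \<in> A}
      = {z \<in> space N. 0 < emeasure (D z) B\<^sub>1} \<inter> (D' -` A' \<inter> space N)"
    unfolding A'(2) by auto
  then show ?thesis
    using measurable_sets[OF D' A'(1)] em by simp
qed

lemma normalized_dom_measurable:
  assumes D: "D \<in> measurable N radon_space"
  shows "{z \<in> space N. 0 < emeasure (D z) B\<^sub>1} \<in> sets N"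
  using measurable_compose[OF D measurable_emeasure_compact[OF compact_sup_ball]] by simp

lemma distr_homeomorphism_measurable:
  fixes f g :: "real^'n \<Rightarrow> real^'n"
  assumes "homeomorphism UNIV UNIV f g"
  shows "(\<lambda>\<mu>. distr \<mu> borel f) \<in> measurable M_star_space radon_space"
  using measurable_compose[OF M_star_to_radon weak_continuous_measurable[OF continuous_distr_homeomorphism[OF assms]]] .

lemma star_dom_measurable:
  assumes "homeomorphism UNIV UNIV f g"
  shows "star_dom f \<in> sets M_star_space"
  using normalized_dom_measurable[OF distr_homeomorphism_measurable[OF assms]] by (simp add: star_dom_def)

lemma star_map_vimage_measurable:
  assumes "homeomorphism UNIV UNIV f g" "A \<in> sets M_star_space"
  shows "{\<mu> \<in> star_dom f. star_map f \<mu> \<in> A} \<in> sets M_star_space"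
  using normalized_set_measurable[OF distr_homeomorphism_measurable[OF assms(1)] assms(2)]
  by (simp add: star_dom_def star_map_def conj_assoc)

lemma star_map_in_M_star:
  assumes "homeomorphism UNIV UNIV f g" "\<mu> \<in> radon_measures" "0 < emeasure (distr \<mu> borel f) B\<^sub>1"
  shows "star_map f \<mu> \<in> M_star"
  unfolding star_map_def
  by (rule normalized_in_M_star[OF radon_distr_homeomorphism[OF assms(2,1)] assms(3)])

lemma sets_star_push [simp]: "sets (star_push f P) = sets M_star_space"
  by (simp add: star_push_def)

text \<open>\<open>distr\<close> has the expected values for measurable maps, and
  \<open>star_map f\<close> is shown to be measurable on its domain. The result replaces the
  restricted space by a preimage measured with \<open>P\<close> itself.\<close>

lemma emeasure_star_push:
  assumes f: "homeomorphism UNIV UNIV f g" and P: "sets P = sets M_star_space"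
    and A: "A \<in> sets M_star_space"
  shows "emeasure (star_push f P) A = emeasure P {\<mu> \<in> star_dom f. star_map f \<mu> \<in> A}"
proof -
  have sp: "space P = M_star" using sets_eq_imp_space_eq[OF P] by simp
  have sub: "star_dom f \<subseteq> M_star" by (auto simp: star_dom_def)
  have dom: "star_dom f \<inter> space P \<in> sets P"
    using star_dom_measurable[OF f] sub P by (simp add: sp Int_absorb2)
  have "star_map f \<in> measurable (restrict_space P (star_dom f)) M_star_space"
  proof (rule measurableI)
    fix \<mu> assume "\<mu> \<in> space (restrict_space P (star_dom f))"
    then show "star_map f \<mu> \<in> space M_star_space"
      using star_map_in_M_star[OF f] M_star_radon by (auto simp: space_restrict_space star_dom_def)
  next
    fix A :: "(real^'a) measure set" assume "A \<in> sets M_star_space"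
    moreover have "star_map f -` A \<inter> space (restrict_space P (star_dom f)) = {\<mu> \<in> star_dom f. star_map f \<mu> \<in> A}"
      using sub by (auto simp: space_restrict_space sp)
    ultimately show "star_map f -` A \<inter> space (restrict_space P (star_dom f)) \<in> sets (restrict_space P (star_dom f))"
      using star_map_vimage_measurable[OF f] dom P by (auto simp: sets_restrict_space_iff)
  qed
  then have "emeasure (star_push f P) A
      = emeasure (restrict_space P (star_dom f)) (star_map f -` A \<inter> space (restrict_space P (star_dom f)))"
    unfolding star_push_def using A by (rule emeasure_distr)
  also have "\<dots> = emeasure P (star_map f -` A \<inter> space (restrict_space P (star_dom f)))"
    using dom by (intro emeasure_restrict_space) (auto simp: space_restrict_space)
  also have "star_map f -` A \<inter> space (restrict_space P (star_dom f)) = {\<mu> \<in> star_dom f. star_map f \<mu> \<in> A}"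
    using sub by (auto simp: space_restrict_space sp)
  finally show ?thesis .
qed

section \<open>Definedness and composition of starred maps\<close>

lemma homeomorphism_measurable:
  assumes "homeomorphism UNIV UNIV f g"
  shows "f \<in> borel_measurable borel"
  using assms by (intro borel_measurable_continuous_onI) (simp add: homeomorphism_def)

lemma emeasure_distr_pos:
  assumes f: "homeomorphism UNIV UNIV f g" and \<mu>: "\<mu> \<in> radon_measures"
    and x: "x \<in> measure_supp \<mu>" and V: "open V" "f x \<in> V"
  shows "0 < emeasure (distr \<mu> borel f) V"
proof -
  have "continuous_on UNIV f" using f by (simp add: homeomorphism_def)
  then have "open (f -` V)" by (rule open_vimage[OF V(1)])
  then show ?thesis
    using x V(2) borel_measurable_radon[OF \<mu> homeomorphism_measurable[OF f]] \<mu> V(1)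
    by (auto simp: measure_supp_def emeasure_distr)
qed

text \<open>The support is tested by open sets whereas \<open>B\<^sub>1\<close> is closed, hence the
  detour through the open Euclidean unit ball inside it.\<close>

lemma emeasure_distr_B1_pos:
  assumes f: "homeomorphism UNIV UNIV f g" and \<mu>: "\<mu> \<in> radon_measures"
    and x: "x \<in> measure_supp \<mu>" and "f x = 0"
  shows "0 < emeasure (distr \<mu> borel f) B\<^sub>1"
  using emeasure_distr_pos[OF f \<mu> x, of "ball 0 1"] emeasure_mono[OF ball_subset_B1, of "distr \<mu> borel f"] assms(4)
  by auto

lemma star_map_scale:
  assumes f: "homeomorphism UNIV UNIV f g" and \<mu>: "\<mu> \<in> radon_measures"
    and pos: "0 < emeasure (distr \<mu> borel f) B\<^sub>1"
  obtains c where "0 < c" "c < \<infinity>" "star_map f \<mu> = scale_measure c (distr \<mu> borel f)"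
  by (rule that[OF normalized_factor(2,3)[OF pos radon_B1_finite[OF radon_distr_homeomorphism[OF \<mu> f]]]])
    (simp add: star_map_def normalized_def)

lemma distr_star_map:
  assumes f: "homeomorphism UNIV UNIV f g" and h: "homeomorphism UNIV UNIV h k"
    and \<mu>: "\<mu> \<in> radon_measures" and pos: "0 < emeasure (distr \<mu> borel f) B\<^sub>1"
  obtains c where "0 < c" "c < \<infinity>"
    "distr (star_map f \<mu>) borel h = scale_measure c (distr \<mu> borel (h \<circ> f))"
proof -
  obtain c where c: "0 < c" "c < \<infinity>" "star_map f \<mu> = scale_measure c (distr \<mu> borel f)"
    using star_map_scale[OF f \<mu> pos] .
  have "distr (star_map f \<mu>) borel h = scale_measure c (distr (distr \<mu> borel f) borel h)"
    unfolding c(3) using homeomorphism_measurable[OF h] by (intro distr_scale_measure) simp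
  also have "distr (distr \<mu> borel f) borel h = distr \<mu> borel (h \<circ> f)"
    by (rule distr_distr[OF homeomorphism_measurable[OF h] borel_measurable_radon[OF \<mu> homeomorphism_measurable[OF f]]])
  finally show ?thesis using that c by blast
qed

lemma star_map_comp_pos_iff:
  assumes f: "homeomorphism UNIV UNIV f g" and h: "homeomorphism UNIV UNIV h k"
    and \<mu>: "\<mu> \<in> radon_measures" and pos: "0 < emeasure (distr \<mu> borel f) B\<^sub>1"
  shows "0 < emeasure (distr (star_map f \<mu>) borel h) B\<^sub>1 \<longleftrightarrow> 0 < emeasure (distr \<mu> borel (h \<circ> f)) B\<^sub>1"
proof -
  obtain c where "0 < c" "distr (star_map f \<mu>) borel h = scale_measure c (distr \<mu> borel (h \<circ> f))"
    using distr_star_map[OF assms] .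
  then show ?thesis by (simp add: ennreal_zero_less_mult_iff)
qed

text \<open>The condition \<open>pos'\<close> is separate from \<open>pos\<close>, because
  \<open>h\<close> may move all the mass out of \<open>B\<^sub>1\<close>.\<close>

lemma star_map_comp:
  assumes f: "homeomorphism UNIV UNIV f g" and h: "homeomorphism UNIV UNIV h k"
    and \<mu>: "\<mu> \<in> radon_measures" and pos: "0 < emeasure (distr \<mu> borel f) B\<^sub>1"
    and pos': "0 < emeasure (distr \<mu> borel (h \<circ> f)) B\<^sub>1"
  shows "star_map h (star_map f \<mu>) = star_map (h \<circ> f) \<mu>"
proof -
  obtain c where c: "0 < c" "c < \<infinity>"
    "distr (star_map f \<mu>) borel h = scale_measure c (distr \<mu> borel (h \<circ> f))"
    using distr_star_map[OF f h \<mu> pos] .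
  have "emeasure (distr \<mu> borel (h \<circ> f)) B\<^sub>1 < \<infinity>"
    by (rule radon_B1_finite[OF radon_distr_homeomorphism[OF \<mu> homeomorphism_compose[OF f h]]])
  then show ?thesis
    unfolding star_map_def[of h] star_map_def[of "h \<circ> f"] c(3)
    by (rule normalized_scale_measure[OF c(1,2) pos'])
qed

section \<open>Measures with the origin in their support\<close>

lemma S_domain_subset_star_dom:
  assumes "homeomorphism UNIV UNIV f g" "f 0 = 0"
  shows "S_domain \<subseteq> star_dom f"
  using emeasure_distr_B1_pos[OF assms(1) M_star_radon _ assms(2)] by (auto simp: S_domain_def star_dom_def)

lemma star_map_S_domain:
  assumes f: "homeomorphism UNIV UNIV f g" and f0: "f 0 = 0" and \<mu>: "\<mu> \<in> S_domain"
  shows "star_map f \<mu> \<in> S_domain"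
proof -
  have rad: "\<mu> \<in> radon_measures" and supp: "0 \<in> measure_supp \<mu>"
    using \<mu> by (auto simp: S_domain_def M_star_radon)
  have pos: "0 < emeasure (distr \<mu> borel f) B\<^sub>1"
    using emeasure_distr_B1_pos[OF f rad supp f0] .
  obtain c where c: "0 < c" "c < \<infinity>" "star_map f \<mu> = scale_measure c (distr \<mu> borel f)"
    using star_map_scale[OF f rad pos] .
  have "0 \<in> measure_supp (star_map f \<mu>)"
    using emeasure_distr_pos[OF f rad supp] c f0 by (auto simp: measure_supp_def ennreal_zero_less_mult_iff)
  then show ?thesis
    using star_map_in_M_star[OF f rad pos] by (simp add: S_domain_def)
qed

text \<open>Countably many balls shrinking to 0 decide membership of 0 in the support. They are
  taken closed because masses of compact sets are known to be measurable.\<close>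

lemma S_domain_measurable: "S_domain \<in> sets (M_star_space :: (real^'n) measure measure)"
proof -
  have "0 \<in> measure_supp \<mu> \<longleftrightarrow> (\<forall>n. 0 < emeasure \<mu> (cball 0 (inverse (Suc n))))"
    if \<mu>: "\<mu> \<in> radon_measures" for \<mu> :: "(real^'n) measure"
  proof (intro iffI allI)
    fix n assume "0 \<in> measure_supp \<mu>"
    then have "0 < emeasure \<mu> (ball 0 (inverse (Suc n)))" by (simp add: measure_supp_def)
    also have "\<dots> \<le> emeasure \<mu> (cball 0 (inverse (Suc n)))"
      using \<mu> by (intro emeasure_mono ball_subset_cball) auto
    finally show "0 < emeasure \<mu> (cball 0 (inverse (Suc n)))" .
  next
    assume *: "\<forall>n. 0 < emeasure \<mu> (cball 0 (inverse (Suc n)))"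
    show "0 \<in> measure_supp \<mu>"
      unfolding measure_supp_def
    proof (intro CollectI allI impI)
      fix V :: "(real^'n) set" assume V: "open V \<and> 0 \<in> V"
      then obtain e where e: "0 < e" "cball 0 e \<subseteq> V" using open_contains_cball by blast
      then obtain n where "inverse (Suc n) < e" using reals_Archimedean by blast
      then have "cball 0 (inverse (Suc n)) \<subseteq> V" using e by (meson order.trans less_imp_le subset_cball)
      from emeasure_mono[OF this, of \<mu>] V \<mu> * show "0 < emeasure \<mu> V"
        by (auto intro: less_le_trans)
    qed
  qed
  then have "S_domain = {\<mu> \<in> space M_star_space. \<forall>n. 0 < emeasure \<mu> (cball (0 :: real^'n) (inverse (Suc n)))}"
    by (auto simp: S_domain_def M_star_radon)
  moreover have [measurable]:
    "(\<lambda>\<mu>. emeasure \<mu> (cball (0 :: real^'n) (inverse (Suc n)))) \<in> borel_measurable M_star_space" for n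
    by (intro measurable_compose[OF M_star_to_radon measurable_emeasure_compact] compact_cball)
  have "{\<mu> \<in> space M_star_space. \<forall>n. 0 < emeasure \<mu> (cball (0 :: real^'n) (inverse (Suc n)))} \<in> sets M_star_space"
    by (intro sets.sets_Collect_countable_All) measurable
  ultimately show ?thesis by simp
qed

text \<open>Every point off the support has a null neighbourhood from a countable basis, so the
  complement is covered by countably many null sets. Relations between starred translations that
  hold on the support thus hold almost everywhere.\<close>

lemma AE_measure_supp:
  assumes \<mu>: "\<mu> \<in> radon_measures"
  shows "AE x in \<mu>. x \<in> measure_supp \<mu>"
proof -
  obtain B :: "(real^'a) set set" where B: "countable B" "topological_basis B"
    using ex_countable_basis by blast
  define N where "N = \<Union>{U \<in> B. emeasure \<mu> U = 0}"
  have "N \<in> null_sets \<mu>"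
    unfolding N_def using B \<mu> topological_basis_open[OF B(2)]
    by (intro null_sets_UN'[where N = "\<lambda>U. U", simplified]) (auto intro!: null_setsI)
  moreover have "{x \<in> space \<mu>. x \<notin> measure_supp \<mu>} \<subseteq> N"
  proof
    fix x assume "x \<in> {x \<in> space \<mu>. x \<notin> measure_supp \<mu>}"
    then obtain V where V: "open V" "x \<in> V" "emeasure \<mu> V = 0"
      by (auto simp: measure_supp_def not_less)
    obtain U where U: "U \<in> B" "x \<in> U" "U \<subseteq> V" using topological_basisE[OF B(2) V(1,2)] .
    have "emeasure \<mu> U \<le> emeasure \<mu> V" using V(1) \<mu> by (intro emeasure_mono[OF U(3)]) simp
    then show "x \<in> N" using U V(3) by (auto simp: N_def)
  qed
  ultimately show ?thesis by (rule AE_I')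
qed

section \<open>Averaged translates\<close>

text \<open>Base point and measure are kept together so that measurability can be proved in the
  product; \<open>translates U \<mu>\<close> then measures a section of this set, cut down to
  \<open>U\<close>.\<close>

definition translate_set :: "(real^'n) measure set \<Rightarrow> ((real^'n) \<times> (real^'n) measure) set" where
  "translate_set A = {(x, \<mu>). \<mu> \<in> M_star \<and> 0 < emeasure (distr \<mu> borel (translation x)) B\<^sub>1
     \<and> star_map (translation x) \<mu> \<in> A}"

lemma translate_set_measurable:
  fixes A :: "(real^'n) measure set"
  assumes A: "A \<in> sets M_star_space"
  shows "translate_set A \<in> sets (borel \<Otimes>\<^sub>M M_star_space)"
proof -
  have "(\<lambda>p. (fst p :: real^'n, snd p)) \<in> measurable (borel \<Otimes>\<^sub>M M_star_space) (borel \<Otimes>\<^sub>M radon_space)"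
    by (intro measurable_Pair measurable_fst measurable_compose[OF measurable_snd M_star_to_radon])
  from measurable_compose[OF this weak_continuous_measurable_pair[OF continuous_translation]]
  have "(\<lambda>p. distr (snd p) borel (translation (fst p :: real^'n))) \<in> measurable (borel \<Otimes>\<^sub>M M_star_space) radon_space"
    by simp
  from normalized_set_measurable[OF this A] show ?thesis
    by (rule back_subst[where P = "\<lambda>S. S \<in> _"])
      (auto simp: translate_set_def star_map_def space_pair_measure)
qed

lemma translate_section_measurable:
  assumes "A \<in> sets M_star_space"
  shows "{x. (x, \<mu>) \<in> translate_set A} \<in> sets borel"
  using sets_Pair2[OF translate_set_measurable[OF assms], of \<mu>] by (simp add: vimage_def)

lemma sets_translates [simp]: "sets (translates U \<mu>) = sets M_star_space"
  by (simp add: translates_def)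

lemma emeasure_translates:
  assumes U: "U \<in> sets borel" and \<mu>: "\<mu> \<in> M_star" and A: "A \<in> sets M_star_space"
  shows "emeasure (translates U \<mu>) A = emeasure \<mu> {x \<in> U. (x, \<mu>) \<in> translate_set A}"
proof -
  define D where "D = {x \<in> U. emeasure (distr \<mu> borel (translation x)) B\<^sub>1 > 0}"
  have rad: "\<mu> \<in> radon_measures" by (rule M_star_radon[OF \<mu>])
  have in_star: "star_map (translation x) \<mu> \<in> M_star" if "x \<in> D" for x
    using that star_map_in_M_star[OF homeomorphism_translation rad] by (auto simp: D_def)
  have sect: "{x \<in> U. (x, \<mu>) \<in> translate_set A} \<in> sets \<mu>" if "A \<in> sets M_star_space" for A
    using translate_section_measurable[OF that] U rad by (simp add: Collect_conj_eq)
  \<comment> \<open>The domain of definition is itself such a section, for the largest target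
    \<open>M_star\<close>; this yields its measurability.\<close>
  have D_eq: "D = {x \<in> U. (x, \<mu>) \<in> translate_set M_star}"
    using in_star \<mu> by (auto simp: D_def translate_set_def)
  have D: "D \<inter> space \<mu> \<in> sets \<mu>"
    using sect[of M_star] sets.top[of M_star_space] rad by (simp add: D_eq)
  have vim: "star_map (translation x) \<mu> \<in> A \<and> x \<in> D \<longleftrightarrow> x \<in> U \<and> (x, \<mu>) \<in> translate_set A" for x A
    using \<mu> by (auto simp: D_def translate_set_def)
  have vim': "(\<lambda>x. star_map (translation x) \<mu>) -` A \<inter> space (restrict_space \<mu> D)
      = {x \<in> U. (x, \<mu>) \<in> translate_set A}" for A
    using vim rad by (auto simp: space_restrict_space)
  have sub: "{x \<in> U. (x, \<mu>) \<in> translate_set A} \<subseteq> D" for A using vim by blast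
  have m: "(\<lambda>x. star_map (translation x) \<mu>) \<in> measurable (restrict_space \<mu> D) M_star_space"
  proof (rule measurableI)
    show "(\<lambda>x. star_map (translation x) \<mu>) -` A \<inter> space (restrict_space \<mu> D) \<in> sets (restrict_space \<mu> D)"
      if "A \<in> sets M_star_space" for A
      unfolding vim' using sect[OF that] sub D by (simp add: sets_restrict_space_iff)
  qed (use in_star in \<open>simp add: space_restrict_space\<close>)
  have "emeasure (translates U \<mu>) A = emeasure (restrict_space \<mu> D) {x \<in> U. (x, \<mu>) \<in> translate_set A}"
    unfolding translates_def D_def[symmetric] emeasure_distr[OF m A] vim' ..
  also have "\<dots> = emeasure \<mu> {x \<in> U. (x, \<mu>) \<in> translate_set A}"
    by (rule emeasure_restrict_space[OF D sub])
  finally show ?thesis .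
qed

lemma translates_measurable:
  fixes U :: "(real^'n) set"
  assumes U: "bounded U" "U \<in> sets borel" and A: "A \<in> sets M_star_space"
  shows "(\<lambda>\<mu>. emeasure (translates U \<mu>) A) \<in> borel_measurable M_star_space"
proof -
  \<comment> \<open>Boundedness of \<open>U\<close> makes its closure compact, as the section lemma
    requires; the set \<open>U\<close> itself is put back as a factor of the product set.\<close>
  have "(\<lambda>\<mu>. emeasure \<mu> {x \<in> closure U. (x, \<mu>) \<in> translate_set A \<inter> U \<times> space M_star_space})
      \<in> borel_measurable M_star_space"
    using U(1) pair_measureI[OF U(2) sets.top] translate_set_measurable[OF A]
    by (intro measurable_emeasure_section[OF M_star_to_radon] sets.Int) (simp_all only: compact_closure)
  moreover have "{x \<in> closure U. (x, \<mu>) \<in> translate_set A \<inter> U \<times> space M_star_space}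
      = {x \<in> U. (x, \<mu>) \<in> translate_set A}" if "\<mu> \<in> M_star" for \<mu>
    using that closure_subset[of U] by auto
  ultimately show ?thesis
    using emeasure_translates[OF U(2) _ A]
    by (subst measurable_cong) auto
qed

lemma sets_averaged_translates [simp]: "sets (averaged_translates U P) = sets M_star_space"
  unfolding averaged_translates_def by (rule sets.sets_measure_of_eq)

text \<open>\<open>measure_of\<close> falls back to the zero measure unless the given set function
  is a measure. Countable additivity is the exchange of sum and integral, for which the
  measurability of the masses of translates is required.\<close>

lemma emeasure_averaged_translates:
  fixes U :: "(real^'n) set"
  assumes P: "sets P = sets M_star_space" and U: "bounded U" "U \<in> sets borel"
    and A: "A \<in> sets M_star_space"
  shows "emeasure (averaged_translates U P) A = (\<integral>\<^sup>+\<mu>. emeasure (translates U \<mu>) A \<partial>P)"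
proof (rule emeasure_measure_of[OF averaged_translates_def[of U P]])
  show "sets M_star_space \<subseteq> Pow (space M_star_space)" by (rule sets.space_closed)
  show "A \<in> sets (averaged_translates U P)" using A by simp
  show "positive (sets (averaged_translates U P)) (\<lambda>A. \<integral>\<^sup>+\<mu>. emeasure (translates U \<mu>) A \<partial>P)"
    by (simp add: positive_def)
  show "countably_additive (sets (averaged_translates U P)) (\<lambda>A. \<integral>\<^sup>+\<mu>. emeasure (translates U \<mu>) A \<partial>P)"
  proof (rule countably_additiveI)
    fix A :: "nat \<Rightarrow> (real^'n) measure set"
    assume A: "range A \<subseteq> sets (averaged_translates U P)" "disjoint_family A"
    have "(\<lambda>\<mu>. emeasure (translates U \<mu>) (A i)) \<in> borel_measurable P" for i
      using translates_measurable[OF U, of "A i"] A(1) P by (auto cong: measurable_cong_sets)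
    then have "(\<Sum>i. \<integral>\<^sup>+\<mu>. emeasure (translates U \<mu>) (A i) \<partial>P)
        = (\<integral>\<^sup>+\<mu>. (\<Sum>i. emeasure (translates U \<mu>) (A i)) \<partial>P)"
      by (rule nn_integral_suminf[symmetric])
    also have "(\<lambda>\<mu>. \<Sum>i. emeasure (translates U \<mu>) (A i)) = (\<lambda>\<mu>. emeasure (translates U \<mu>) (\<Union>i. A i))"
      using A by (intro ext suminf_emeasure) auto
    finally show "(\<Sum>i. \<integral>\<^sup>+\<mu>. emeasure (translates U \<mu>) (A i) \<partial>P)
        = (\<integral>\<^sup>+\<mu>. emeasure (translates U \<mu>) (\<Union>i. A i) \<partial>P)" .
  qed
qed

text \<open>A nonnegative integral vanishes exactly when its integrand does almost everywhere. The
  quasi-Palm property thereby becomes a statement about almost every \<mu>.\<close>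

lemma null_sets_averaged_translates:
  assumes P: "sets P = sets M_star_space" and U: "bounded U" "U \<in> sets borel"
  shows "A \<in> null_sets (averaged_translates U P) \<longleftrightarrow>
    A \<in> sets M_star_space \<and> (AE \<mu> in P. emeasure (translates U \<mu>) A = 0)"
proof (cases "A \<in> sets M_star_space")
  case True
  have "(\<lambda>\<mu>. emeasure (translates U \<mu>) A) \<in> borel_measurable P"
    using translates_measurable[OF U True] P by (simp cong: measurable_cong_sets)
  then show ?thesis
    using True by (simp add: null_sets_def emeasure_averaged_translates[OF P U] nn_integral_0_iff_AE)
qed (simp add: null_sets_def)

text \<open>The proportionality factor between the two masses varies with \<mu>, so the averages
  themselves are not proportional; vanishing, however, can be compared for each \<mu>
  separately.\<close>

lemma translates_star_map_null_iff:
  fixes L :: "real^'n \<Rightarrow> real^'n"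
  assumes L: "linear L" "homeomorphism UNIV UNIV L g" and U: "U \<in> sets borel"
    and A: "A \<in> sets M_star_space" and \<mu>: "\<mu> \<in> star_dom L"
  shows "emeasure (translates U (star_map L \<mu>)) A = 0 \<longleftrightarrow>
    emeasure (translates (L -` U) \<mu>) {\<mu> \<in> star_dom L. star_map L \<mu> \<in> A} = 0"
proof -
  have \<mu>M: "\<mu> \<in> M_star" and pos: "0 < emeasure (distr \<mu> borel L) B\<^sub>1"
    using \<mu> by (auto simp: star_dom_def)
  have rad: "\<mu> \<in> radon_measures" by (rule M_star_radon[OF \<mu>M])
  let ?A' = "{\<mu> \<in> star_dom L. star_map L \<mu> \<in> A}" and ?\<nu> = "star_map L \<mu>"
  have A': "?A' \<in> sets M_star_space" by (rule star_map_vimage_measurable[OF L(2) A])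
  have \<nu>M: "?\<nu> \<in> M_star" by (rule star_map_in_M_star[OF L(2) rad pos])
  have mL: "L \<in> borel_measurable borel" by (rule homeomorphism_measurable[OF L(2)])
  have mL\<mu>: "L \<in> borel_measurable \<mu>" by (rule borel_measurable_radon[OF rad mL])
  have V: "L -` U \<in> sets borel" using measurable_sets[OF mL U] by simp
  let ?S = "{x \<in> U. (x, ?\<nu>) \<in> translate_set A}" and ?S' = "{y \<in> L -` U. (y, \<mu>) \<in> translate_set ?A'}"
  have S: "?S \<in> sets borel"
    using translate_section_measurable[OF A] U by (simp add: Collect_conj_eq)
  have S': "?S' \<in> sets borel"
    using sets.Int[OF V translate_section_measurable[OF A']] by (simp only: Collect_conj_eq Collect_mem_eq)
  obtain c where c: "0 < c" "c < \<infinity>" "?\<nu> = scale_measure c (distr \<mu> borel L)"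
    using star_map_scale[OF L(2) rad pos] .
  \<comment> \<open>Off the support one of the starred maps may be undefined and the two sets may
    differ; on it every mass involved is positive.\<close>
  have "y \<in> L -` ?S \<longleftrightarrow> y \<in> ?S'" if y: "y \<in> measure_supp \<mu>" for y
  proof -
    note T = homeomorphism_translation[of y] and TL = homeomorphism_translation[of "L y"]
    note LT = homeomorphism_compose[OF T L(2)]
    have comm: "translation (L y) \<circ> L = L \<circ> translation y"
      using L(1) by (auto simp: translation_def linear_diff)
    have posT: "0 < emeasure (distr \<mu> borel (translation y)) B\<^sub>1"
      by (rule emeasure_distr_B1_pos[OF T rad y]) (simp add: translation_def)
    have posLT: "0 < emeasure (distr \<mu> borel (L \<circ> translation y)) B\<^sub>1"
      by (rule emeasure_distr_B1_pos[OF LT rad y]) (simp add: translation_def linear_0[OF L(1)])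
    have posTL: "0 < emeasure (distr \<mu> borel (translation (L y) \<circ> L)) B\<^sub>1"
      using posLT by (simp only: comm)
    have "star_map (translation (L y)) ?\<nu> = star_map L (star_map (translation y) \<mu>)"
      unfolding star_map_comp[OF L(2) TL rad pos posTL] star_map_comp[OF T L(2) rad posT posLT] comm ..
    moreover have "0 < emeasure (distr ?\<nu> borel (translation (L y))) B\<^sub>1"
      using star_map_comp_pos_iff[OF L(2) TL rad pos] posTL by simp
    moreover have "star_map (translation y) \<mu> \<in> star_dom L"
      using star_map_comp_pos_iff[OF T L(2) rad posT] posLT star_map_in_M_star[OF T rad posT]
      by (simp add: star_dom_def)
    ultimately show ?thesis
      using posT \<nu>M \<mu>M by (simp add: translate_set_def)
  qed
  then have "AE y in \<mu>. y \<in> L -` ?S \<longleftrightarrow> y \<in> ?S'"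
    using AE_measure_supp[OF rad] by (auto elim: eventually_mono)
  then have "emeasure \<mu> (L -` ?S) = emeasure \<mu> ?S'"
    using measurable_sets[OF mL S] S' rad by (intro emeasure_eq_AE) auto
  moreover have "emeasure ?\<nu> ?S = c * emeasure \<mu> (L -` ?S)"
    using c(3) emeasure_distr[OF mL\<mu> S] rad by simp
  ultimately have "emeasure (translates U ?\<nu>) A = c * emeasure (translates (L -` U) \<mu>) ?A'"
    unfolding emeasure_translates[OF U \<nu>M A] emeasure_translates[OF V \<mu>M A'] by simp
  then show ?thesis using c(1) by auto
qed

section \<open>Almost-sure statements and composition under push-forward\<close>

lemma AE_star_push_iff:
  assumes f: "homeomorphism UNIV UNIV f g" and P: "sets P = sets M_star_space"
    and Q: "{\<nu> \<in> M_star. Q \<nu>} \<in> sets M_star_space" and dom: "AE \<mu> in P. \<mu> \<in> star_dom f"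
  shows "(AE \<nu> in star_push f P. Q \<nu>) \<longleftrightarrow> (AE \<mu> in P. Q (star_map f \<mu>))"
proof -
  have sp: "space P = M_star" using sets_eq_imp_space_eq[OF P] by simp
  have spQ: "space (star_push f P) = M_star" by (simp add: star_push_def)
  let ?N = "{\<nu> \<in> M_star. \<not> Q \<nu>}"
  have "?N = space M_star_space - {\<nu> \<in> M_star. Q \<nu>}" by auto
  then have N: "?N \<in> sets M_star_space" using Q by (metis sets.compl_sets)
  have "(AE \<nu> in star_push f P. Q \<nu>) \<longleftrightarrow> emeasure (star_push f P) ?N = 0"
    using N by (intro AE_iff_measurable) (auto simp: spQ)
  also have "\<dots> \<longleftrightarrow> emeasure P {\<mu> \<in> star_dom f. star_map f \<mu> \<in> ?N} = 0"
    by (simp add: emeasure_star_push[OF f P N])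
  also have "\<dots> \<longleftrightarrow> (AE \<mu> in P. \<not> (\<mu> \<in> star_dom f \<and> star_map f \<mu> \<in> ?N))"
    using star_map_vimage_measurable[OF f N] P
    by (intro AE_iff_measurable[symmetric]) (auto simp: sp star_dom_def zero_less_iff_neq_zero)
  \<comment> \<open>\<open>star_push\<close> says nothing about measures outside
    \<open>star_dom f\<close>; they are negligible by \<open>dom\<close>.\<close>
  also have "\<dots> \<longleftrightarrow> (AE \<mu> in P. Q (star_map f \<mu>))"
  proof -
    have "star_map f \<mu> \<in> M_star" if "\<mu> \<in> star_dom f" for \<mu>
      using that star_map_in_M_star[OF f] M_star_radon by (auto simp: star_dom_def)
    then show ?thesis
      using dom by (intro iffI; elim eventually_elim2[OF dom]) auto
  qed
  finally show ?thesis .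
qed

text \<open>In general \<open>star_map (h \<circ> f)\<close> may be defined where
  \<open>star_map f\<close> is not, and the two sides would then differ. As \<open>f\<close> fixes
  0, this cannot happen on \<open>S_domain\<close>.\<close>

lemma star_push_comp:
  assumes f: "homeomorphism UNIV UNIV f g" and h: "homeomorphism UNIV UNIV h k"
    and P: "sets P = sets M_star_space" and f0: "f 0 = 0" and S: "AE \<mu> in P. \<mu> \<in> S_domain"
  shows "star_push h (star_push f P) = star_push (h \<circ> f) P"
proof (rule measure_eqI)
  note hf = homeomorphism_compose[OF f h]
  fix A assume "A \<in> sets (star_push h (star_push f P))"
  then have A: "A \<in> sets M_star_space" by simp
  let ?A' = "{\<mu> \<in> star_dom h. star_map h \<mu> \<in> A}"
  have A': "?A' \<in> sets M_star_space" by (rule star_map_vimage_measurable[OF h A])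
  have "emeasure (star_push h (star_push f P)) A = emeasure P {\<mu> \<in> star_dom f. star_map f \<mu> \<in> ?A'}"
    using emeasure_star_push[OF h _ A, of "star_push f P"] emeasure_star_push[OF f P A'] by simp
  also have "\<dots> = emeasure P {\<mu> \<in> star_dom (h \<circ> f). star_map (h \<circ> f) \<mu> \<in> A}"
  proof (rule emeasure_eq_AE)
    have "\<mu> \<in> star_dom f \<and> star_map f \<mu> \<in> ?A' \<longleftrightarrow> \<mu> \<in> star_dom (h \<circ> f) \<and> star_map (h \<circ> f) \<mu> \<in> A"
      if "\<mu> \<in> S_domain" for \<mu>
    proof -
      have dom: "\<mu> \<in> star_dom f" using that S_domain_subset_star_dom[OF f f0] by blast
      then have \<mu>: "\<mu> \<in> M_star" "\<mu> \<in> radon_measures" "0 < emeasure (distr \<mu> borel f) B\<^sub>1"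
        by (auto simp: star_dom_def M_star_radon)
      have "star_map f \<mu> \<in> star_dom h \<longleftrightarrow> \<mu> \<in> star_dom (h \<circ> f)"
        using star_map_comp_pos_iff[OF f h \<mu>(2,3)] star_map_in_M_star[OF f \<mu>(2,3)] \<mu>(1)
        by (simp add: star_dom_def)
      then show ?thesis
        using dom star_map_comp[OF f h \<mu>(2,3)] by (auto simp: star_dom_def)
    qed
    then show "AE \<mu> in P. \<mu> \<in> {\<mu> \<in> star_dom f. star_map f \<mu> \<in> ?A'}
        \<longleftrightarrow> \<mu> \<in> {\<mu> \<in> star_dom (h \<circ> f). star_map (h \<circ> f) \<mu> \<in> A}"
      using S by (auto elim!: eventually_mono)
  qed (use star_map_vimage_measurable[OF f A'] star_map_vimage_measurable[OF hf A] P in auto)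
  also have "\<dots> = emeasure (star_push (h \<circ> f) P) A" by (rule emeasure_star_push[OF hf P A, symmetric])
  finally show "emeasure (star_push h (star_push f P)) A = emeasure (star_push (h \<circ> f) P) A" .
qed simp

lemma homeomorphism_dilation: "homeomorphism UNIV UNIV (dilation t) (dilation (- t))"
  by (rule homeomorphismI) (auto simp: dilation_def exp_minus intro!: continuous_intros)

lemma dilation_0: "dilation t 0 = 0"
  by (simp add: dilation_def)

lemma homeomorphism_linear_bij:
  fixes L :: "real^'n \<Rightarrow> real^'n"
  assumes "linear L" "bij L"
  shows "homeomorphism UNIV UNIV L (inv L)"
  using assms inj_linear_imp_inv_linear[OF assms(1)]
  by (intro homeomorphismI linear_continuous_on)
    (auto simp: linear_linear bij_is_inj bij_is_surj surj_f_inv_f)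

theorem proposition1p8:
  fixes L :: "real^'n \<Rightarrow> real^'n"
    and P :: "(real^'n) measure measure"
  assumes "linear L" and "bij L"
    and "ergodic_fractal_distribution P"
  shows "ergodic_fractal_distribution (star_push L P)"
proof -
  have P: "sets P = sets M_star_space" and prob: "prob_space P"
    and S: "AE \<mu> in P. \<mu> \<in> S_domain" and inv: "\<And>t. star_push (dilation t) P = P"
    and qP: "quasi_Palm P" and erg: "S_ergodic P"
    using assms(3) by (auto simp: ergodic_fractal_distribution_def fractal_distribution_def
        distribution_on_M_star_def S_invariant_def)
  interpret prob_space P by (rule prob)
  let ?Q = "star_push L P"
  have sp: "space P = M_star" using sets_eq_imp_space_eq[OF P] by simp
  have L: "homeomorphism UNIV UNIV L (inv L)" by (rule homeomorphism_linear_bij[OF assms(1,2)])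
  have L0: "L 0 = 0" by (rule linear_0[OF assms(1)])
  have comm: "dilation t \<circ> L = L \<circ> dilation t" for t
    using assms(1) by (auto simp: dilation_def linear_cmul)
  have dom: "AE \<mu> in P. \<mu> \<in> star_dom L"
    using S S_domain_subset_star_dom[OF L L0] by (auto elim!: eventually_mono)
  have emQ: "emeasure ?Q A = emeasure P {\<mu> \<in> star_dom L. star_map L \<mu> \<in> A}" if "A \<in> sets M_star_space" for A
    by (rule emeasure_star_push[OF L P that])

  \<comment> \<open>Total mass 1 amounts to the starred map being defined \<open>P\<close>-almost
    everywhere.\<close>
  have "prob_space ?Q"
  proof
    have "space ?Q = M_star" by (simp add: star_push_def)
    have "emeasure ?Q M_star = emeasure P {\<mu> \<in> star_dom L. star_map L \<mu> \<in> M_star}"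
      using emQ[OF sets.top] by simp
    also have "\<dots> = emeasure P (space P)"
    proof (rule emeasure_eq_AE)
      show "AE \<mu> in P. \<mu> \<in> {\<mu> \<in> star_dom L. star_map L \<mu> \<in> M_star} \<longleftrightarrow> \<mu> \<in> space P"
        using dom
      proof eventually_elim
        case (elim \<mu>)
        then show ?case
          using star_map_in_M_star[OF L M_star_radon] by (auto simp: star_dom_def sp)
      qed
    qed (use star_map_vimage_measurable[OF L sets.top] P in auto)
    finally show "emeasure ?Q (space ?Q) = 1"
      using \<open>space ?Q = M_star\<close> emeasure_space_1 by simp
  qed
  then have dist: "distribution_on_M_star ?Q"
    by (simp add: distribution_on_M_star_def)

  have "AE \<nu> in ?Q. \<nu> \<in> S_domain"
  proof (subst AE_star_push_iff[OF L P _ dom])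
    have "{\<nu> \<in> M_star. \<nu> \<in> S_domain} = (S_domain :: (real^'n) measure set)"
      by (auto simp: S_domain_def)
    then show "{\<nu> \<in> M_star. \<nu> \<in> (S_domain :: (real^'n) measure set)} \<in> sets M_star_space"
      using S_domain_measurable by simp
    show "AE \<mu> in P. star_map L \<mu> \<in> S_domain"
      using S star_map_S_domain[OF L L0] by (auto elim!: eventually_mono)
  qed
  \<comment> \<open>Both compositions are formed over \<open>P\<close>, where \<open>S\<close> and
    \<open>inv\<close> are available: merge, swap the two linear maps, split again, and absorb the
    dilation into \<open>P\<close>.\<close>
  moreover have "star_push (dilation t) ?Q = ?Q" for t
    unfolding star_push_comp[OF L homeomorphism_dilation P L0 S] comm
      star_push_comp[OF homeomorphism_dilation L P dilation_0 S, symmetric] inv ..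
  ultimately have S_inv: "S_invariant ?Q" by (simp add: S_invariant_def)

  have "quasi_Palm ?Q"
    unfolding quasi_Palm_def
  proof (intro allI impI set_eqI)
    fix U :: "(real^'n) set" and A :: "(real^'n) measure set"
    assume U: "bounded U \<and> open U \<and> 0 \<in> U"
    let ?V = "L -` U" and ?A' = "{\<mu> \<in> star_dom L. star_map L \<mu> \<in> A}"
    have "open ?V" using U L by (intro open_vimage) (auto simp: homeomorphism_def)
    moreover have "?V = inv L ` U" using bij_vimage_eq_inv_image[OF assms(2)] .
    then have "bounded ?V"
      using U bounded_linear_image[of U "inv L"] inj_linear_imp_inv_linear[OF assms(1) bij_is_inj[OF assms(2)]]
      by (simp add: linear_linear)
    ultimately have V: "bounded ?V" "open ?V" "0 \<in> ?V" using U L0 by auto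
    show "A \<in> null_sets ?Q \<longleftrightarrow> A \<in> null_sets (averaged_translates U ?Q)"
    proof (cases "A \<in> sets M_star_space")
      case True
      have A': "?A' \<in> sets M_star_space" by (rule star_map_vimage_measurable[OF L True])
      have Um: "U \<in> sets borel" using U by simp
      \<comment> \<open>Almost-sure statements are transported along \<open>star_push\<close> only
        for measurable events.\<close>
      have km: "{\<nu> \<in> M_star. emeasure (translates U \<nu>) A = 0} \<in> sets M_star_space"
        using measurable_sets[OF translates_measurable[OF _ Um True], of "{0}"] U
        by (auto simp: vimage_def Int_def conj_commute)
      have "A \<in> null_sets (averaged_translates U ?Q) \<longleftrightarrow> (AE \<nu> in ?Q. emeasure (translates U \<nu>) A = 0)"
        using True U by (subst null_sets_averaged_translates) auto
      also have "\<dots> \<longleftrightarrow> (AE \<mu> in P. emeasure (translates U (star_map L \<mu>)) A = 0)"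
        by (rule AE_star_push_iff[OF L P km dom])
      also have "\<dots> \<longleftrightarrow> (AE \<mu> in P. emeasure (translates ?V \<mu>) ?A' = 0)"
        using dom translates_star_map_null_iff[OF assms(1) L Um True]
        by (intro iffI; elim eventually_elim2[OF dom]) auto
      also have "\<dots> \<longleftrightarrow> ?A' \<in> null_sets (averaged_translates ?V P)"
        using A' V P by (subst null_sets_averaged_translates) auto
      also have "\<dots> \<longleftrightarrow> ?A' \<in> null_sets P"
        using qP V unfolding quasi_Palm_def by blast
      also have "\<dots> \<longleftrightarrow> A \<in> null_sets ?Q"
        using A' True P by (simp add: null_sets_def emQ)
      finally show ?thesis by simp
    qed (simp add: null_sets_def)
  qed
  with dist S_inv have "fractal_distribution ?Q" by (simp add: fractal_distribution_def)

  moreover have "S_ergodic ?Q"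
    unfolding S_ergodic_def
  proof (intro ballI impI)
    fix A assume "A \<in> sets ?Q" and A_inv: "A \<subseteq> S_domain \<and> (\<forall>t. {\<mu> \<in> S_domain. star_map (dilation t) \<mu> \<in> A} = A)"
    then have A: "A \<in> sets M_star_space" by simp
    \<comment> \<open>Ergodicity of \<open>P\<close> is tested on subsets of
      \<open>S_domain\<close>, which \<open>?A'\<close> may leave; \<open>?B\<close> is the part
      inside and has the same \<open>P\<close>-mass.\<close>
    let ?A' = "{\<mu> \<in> star_dom L. star_map L \<mu> \<in> A}" and ?B = "{\<mu> \<in> S_domain. star_map L \<mu> \<in> A}"
    note A' = star_map_vimage_measurable[OF L A]
    have B_eq: "?B = S_domain \<inter> ?A'" using S_domain_subset_star_dom[OF L L0] by auto
    then have B: "?B \<in> sets P" using S_domain_measurable A' P by auto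
    have "star_map L (star_map (dilation t) \<mu>) = star_map (dilation t) (star_map L \<mu>)"
      if \<mu>: "\<mu> \<in> S_domain" for t \<mu>
    proof -
      note D = homeomorphism_dilation[of t]
      have rad: "\<mu> \<in> radon_measures" and supp: "0 \<in> measure_supp \<mu>"
        using \<mu> by (auto simp: S_domain_def M_star_radon)
      note pos = emeasure_distr_B1_pos[OF _ rad supp]
      have posL: "0 < emeasure (distr \<mu> borel L) B\<^sub>1" by (rule pos[OF L L0])
      have posD: "0 < emeasure (distr \<mu> borel (dilation t)) B\<^sub>1" by (rule pos[OF D dilation_0])
      have posLD: "0 < emeasure (distr \<mu> borel (L \<circ> dilation t)) B\<^sub>1"
        by (rule pos[OF homeomorphism_compose[OF D L]]) (simp add: L0 dilation_0)
      then have posDL: "0 < emeasure (distr \<mu> borel (dilation t \<circ> L)) B\<^sub>1" by (simp only: comm)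
      show ?thesis
        unfolding star_map_comp[OF D L rad posD posLD] star_map_comp[OF L D rad posL posDL] comm ..
    qed
    \<comment> \<open>Both starred maps preserve \<open>S_domain\<close> and commute on it, so the
      condition on the dilated measure says that the dilate of \<open>star_map L \<mu>\<close> lies
      in \<open>A\<close>; by invariance of \<open>A\<close> this holds exactly when
      \<open>star_map L \<mu>\<close> does.\<close>
    then have "{\<mu> \<in> S_domain. star_map (dilation t) \<mu> \<in> ?B} = ?B" for t
      using A_inv star_map_S_domain[OF L L0] star_map_S_domain[OF homeomorphism_dilation dilation_0]
      by auto blast+
    then have "measure P ?B = 0 \<or> measure P ?B = 1"
      using erg B unfolding S_ergodic_def by blast
    moreover have "emeasure P ?B = emeasure P ?A'"
      using S B A' P by (intro emeasure_eq_AE) (auto simp: B_eq elim!: eventually_mono)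
    ultimately show "measure ?Q A = 0 \<or> measure ?Q A = 1"
      by (simp add: measure_def emQ[OF A])
  qed
  ultimately show ?thesis by (simp add: ergodic_fractal_distribution_def)
qed

end
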